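(* Suppose the strong Slater assumption holds for the constraints of the convex problem (CVX$_\epsilon$). If $\gamma>0$ is larger than the largest magnitude Lagrange multiplier associated with the minimizers of (CVX$_\epsilon$), then the set of stationary points of $\Theta_\gamma$ (points $z$ with $0\in\partial\Theta_\gamma(z)$) coincides with the set of minimizers of (CVX$_\epsilon$).
   Context: $|w|_+=\max\{0,w\}$, elementwise on vectors, as is squaring; $1$ is a vector of ones; $\mathbb{R}_+$ denotes the nonnegative reals; $\tilde I_{\mathcal Z}$ is the indicator function of $\mathcal Z$ ($0$ on $\mathcal Z$, $+\infty$ off $\mathcal Z$). Setting (convex optimal control, fixed $t_{\mathrm i}<t_{\mathrm f}$, $\epsilon>0$): linear dynamics $\dot x(t)=A(t)x(t)+B(t)u(t)+w(t)$, $x\in\mathbb{R}^{n_x}$, $u\in\mathbb{R}^{n_u}$. All functions $L,Y,g,h,P,Q$ are continuously differentiable. The terminal cost $L(t_{\mathrm f},\cdot)$ is convex in the terminal state; the running cost $Y:\mathbb{R}_+\times\mathbb{R}^{n_x}\times\mathbb{R}^{n_u}\to\mathbb{R}$ and each component of the path constraint function $g$ (values in $\mathbb{R}^{n_g}$) are jointly convex in $(x,u)$; $h$ (values in $\mathbb{R}^{n_h}$) is affine in $(x,u)$; the boundary function $P(t_{\mathrm i},x_1,t_{\mathrm f},x_N)$ (values in $\mathbb{R}^{n_P}$) is convex componentwise and $Q(t_{\mathrm i},x_1,t_{\mathrm f},x_N)$ (values in $\mathbb{R}^{n_Q}$) is affine in $(x_1,x_N)$. Control parameterization: $\nu(t)=(\Gamma_u(t)\otimes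 I_{n_u})U$, $\Gamma_u$ a row vector of $N_u$ (piecewise) polynomial basis functions on $[t_{\mathrm i},t_{\mathrm f}]$, $U\in\mathbb{R}^{n_uN_u}$. Grid: $t_{\mathrm i}=t_1<\dots<t_N=t_{\mathrm f}$. On $[t_k,t_{k+1}]$, $x^k(t)=\Phi_x(t,t_k)x_k+\Phi_u(t,t_k)U+\phi(t,t_k)$, where $\dot\Phi_x=A\Phi_x$, $\dot\Phi_u=A\Phi_u+\Gamma_u\otimes B$, $\dot\phi=A\phi+w$, with $\Phi_x(t_k,t_k)=I$, $\Phi_u(t_k,t_k)=0$, $\phi(t_k,t_k)=0$; $A_k=\Phi_x(t_{k+1},t_k)$, $B_k=\Phi_u(t_{k+1},t_k)$, $w_k=\phi(t_{k+1},t_k)$. For $k=1,\dots,N-1$: $$\xi_k(x_k,U)=\int_{t_k}^{t_{k+1}}1^\top|g(t,x^k(t),\nu(t))|_+^2+1^\top h(t,x^k(t),\nu(t))^2\,\mathrm dt,\qquad Y_k(x_k,U)=\int_{t_k}^{t_{k+1}}Y(t,x^k(t),\nu(t))\,\mathrm dt .$$ Problem (CVX$_\epsilon$): minimize $L(t_{\mathrm f},x_N)+\sum_{k=1}^{N-1}Y_k(x_k,U)$ over $z=(X,U)$, $X=(x_1,\dots,x_N)\in\mathbb{R}^{n_xN}$, subject to $x_{k+1}=A_kx_k+B_kU+w_k$ and $\xi_k(x_k,U)\le\epsilon$ for $k=1,\dots,N-1$, $U\in\mathcal U$ (a compact convex set, described by finitely many convex inequalities and affine equalities), $P(t_{\mathrm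 i},x_1,t_{\mathrm f},x_N)\le0$, $Q(t_{\mathrm i},x_1,t_{\mathrm f},x_N)=0$. It is understood that (CVX$_\epsilon$) has minimizers. Lagrange multipliers are the multipliers in the KKT conditions for all these constraints. Strong Slater assumption: the (gradients of the) affine equality constraints are linearly independent, and there is a point satisfying all affine equality constraints and satisfying all convex inequality constraints strictly. Penalized function: for $\gamma>0$, $$\Theta_\gamma(z)=L(t_{\mathrm f},x_N)+\sum_{k=1}^{N-1}Y_k(x_k,U)+\tilde I_{\mathcal Z}(z)+\gamma\sum_{k=1}^{N-1}|\xi_k(x_k,U)-\epsilon|_+,$$ where $\mathcal Z$ is the set of $z=(X,U)$ with $U\in\mathcal U$, $x_{k+1}=A_kx_k+B_kU+w_k$ ($1\le k\le N-1$), $P(t_{\mathrm i},x_1,t_{\mathrm f},x_N)\le0$ and $Q(t_{\mathrm i},x_1,t_{\mathrm f},x_N)=0$; $\partial$ is the convex subdifferential. *)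

theory Defs
  imports "HOL-Analysis.Analysis"
begin

section \<open>General notions\<close>

definition pos_part :: "real \<Rightarrow> real" where
  "pos_part r = max 0 r"

text \<open>Continuous differentiability on a set that need not be open (the time axis is the closed
  half-line, where the derivative at 0 is one-sided).\<close>

definition C1_on :: "'a::real_normed_vector set \<Rightarrow> ('a \<Rightarrow> 'b::real_normed_vector) \<Rightarrow> bool" where
  "C1_on S f \<longleftrightarrow> (\<exists>f' :: 'a \<Rightarrow> 'a \<Rightarrow>\<^sub>L 'b.
     (\<forall>x\<in>S. (f has_derivative blinfun_apply (f' x)) (at x within S)) \<and> continuous_on S f')"

definition affine_fun :: "('a::real_vector \<Rightarrow> real) \<Rightarrow> bool" where
  "affine_fun f \<longleftrightarrow> (\<exists>l c. linear l \<and> f = (\<lambda>x. l x + c))"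

text \<open>No condition is imposed at the finitely many breakpoints, where the function may jump.\<close>

definition piecewise_polynomial_on :: "real \<Rightarrow> real \<Rightarrow> (real \<Rightarrow> real) \<Rightarrow> bool" where
  "piecewise_polynomial_on a b f \<longleftrightarrow> (\<exists>S. finite S \<and>
     (\<forall>c d. c < d \<and> {c<..<d} \<subseteq> {a..b} - S \<longrightarrow>
        (\<exists>q :: real poly. \<forall>t\<in>{c<..<d}. f t = poly q t)))"

text \<open>A continuous solution of \<open>y' = F t y\<close>, \<open>y a = y0\<close> on \<open>[a, b]\<close>. Finitely many exceptional
  times are allowed because the right-hand side may jump at breakpoints of the control basis.\<close>

definition solves_ivp ::
    "(real \<Rightarrow> 'a \<Rightarrow> 'a) \<Rightarrow> real \<Rightarrow> real \<Rightarrow> 'a \<Rightarrow> (real \<Rightarrow> 'a::real_normed_vector) \<Rightarrow> bool" where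
  "solves_ivp F a b y0 y \<longleftrightarrow> y a = y0 \<and> continuous_on {a..b} y \<and>
     (\<exists>S. finite S \<and>
        (\<forall>t\<in>{a..b} - S. (y has_vector_derivative F t (y t)) (at t within {a..b})))"

text \<open>The Kronecker product of a row vector with a matrix; the column index \<open>(j, l)\<close> stands for
  column \<open>l\<close> of block \<open>j\<close>.\<close>

definition row_kron :: "real^'j \<Rightarrow> real^'l^'i \<Rightarrow> real^('j \<times> 'l)^'i" where
  "row_kron v M = (\<chi> i p. v $ fst p * M $ i $ snd p)"

definition subdifferential :: "('a::real_inner \<Rightarrow> ereal) \<Rightarrow> 'a \<Rightarrow> 'a set" where
  "subdifferential f z =
     {s. \<bar>f z\<bar> \<noteq> \<infinity> \<and> (\<forall>y. f z + ereal (s \<bullet> (y - z)) \<le> f y)}"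

definition gradient :: "('a::real_inner \<Rightarrow> real) \<Rightarrow> 'a \<Rightarrow> 'a" where
  "gradient f z = (THE D. GDERIV f z :> D)"

section \<open>The optimal control problem\<close>

text \<open>Vector-valued constraint functions are given by their component functions, numbered from 0,
  so that any of the numbers of constraints may be zero. The grid nodes are numbered
  \<open>1, \<dots>, N\<close> with \<open>N = CARD('N)\<close>; \<open>node\<close> enumerates the index type \<open>'N\<close> accordingly, so that
  \<open>X = (x_1, \<dots>, x_N)\<close> lives in the Euclidean space \<open>(real^'nx)^'N\<close> with \<open>x_k = X $ node k\<close>.\<close>

record ('nx, 'nu, 'Nu, 'N) ocp =
  t_ini :: real
  t_fin :: real
  eps :: real
  dynA :: "real \<Rightarrow> real^'nx^'nx"
  dynB :: "real \<Rightarrow> real^'nu^'nx"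
  dynw :: "real \<Rightarrow> real^'nx"
  costL :: "real \<Rightarrow> real^'nx \<Rightarrow> real"
  costY :: "real \<Rightarrow> real^'nx \<Rightarrow> real^'nu \<Rightarrow> real"
  n_g :: nat
  path_g :: "nat \<Rightarrow> real \<Rightarrow> real^'nx \<Rightarrow> real^'nu \<Rightarrow> real"
  n_h :: nat
  path_h :: "nat \<Rightarrow> real \<Rightarrow> real^'nx \<Rightarrow> real^'nu \<Rightarrow> real"
  n_P :: nat
  bnd_P :: "nat \<Rightarrow> real \<Rightarrow> real^'nx \<Rightarrow> real \<Rightarrow> real^'nx \<Rightarrow> real"
  n_Q :: nat
  bnd_Q :: "nat \<Rightarrow> real \<Rightarrow> real^'nx \<Rightarrow> real \<Rightarrow> real^'nx \<Rightarrow> real"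
  n_Uineq :: nat
  U_ineq :: "nat \<Rightarrow> real^('Nu \<times> 'nu) \<Rightarrow> real"
  n_Ueq :: nat
  U_eq :: "nat \<Rightarrow> real^('Nu \<times> 'nu) \<Rightarrow> real"
  Gamma_u :: "real \<Rightarrow> real^'Nu"
  node :: "nat \<Rightarrow> 'N"
  grid :: "nat \<Rightarrow> real"
  Phi_x :: "nat \<Rightarrow> real \<Rightarrow> real^'nx^'nx"
  Phi_u :: "nat \<Rightarrow> real \<Rightarrow> real^('Nu \<times> 'nu)^'nx"
  phi_w :: "nat \<Rightarrow> real \<Rightarrow> real^'nx"

type_synonym ('nx, 'nu, 'Nu, 'N) decision = "((real^'nx)^'N) \<times> (real^('Nu \<times> 'nu))"

definition U_set :: "('nx::finite, 'nu::finite, 'Nu::finite, 'N::finite) ocp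
    \<Rightarrow> (real^('Nu \<times> 'nu)) set" where
  "U_set p = {U. (\<forall>i<n_Uineq p. U_ineq p i U \<le> 0) \<and> (\<forall>j<n_Ueq p. U_eq p j U = 0)}"

definition control :: "('nx::finite, 'nu::finite, 'Nu::finite, 'N::finite) ocp
    \<Rightarrow> real^('Nu \<times> 'nu) \<Rightarrow> real \<Rightarrow> real^'nu" where
  "control p U t = row_kron (Gamma_u p t) (mat 1) *v U"

text \<open>\<open>Phi_x p k t\<close>, \<open>Phi_u p k t\<close> and \<open>phi_w p k t\<close> stand for the transition maps from time
  \<open>grid p k\<close> to time \<open>t\<close>.\<close>

definition state :: "('nx::finite, 'nu::finite, 'Nu::finite, 'N::finite) ocp
    \<Rightarrow> nat \<Rightarrow> real^'nx \<Rightarrow> real^('Nu \<times> 'nu) \<Rightarrow> real \<Rightarrow> real^'nx" where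
  "state p k x U t = Phi_x p k t *v x + Phi_u p k t *v U + phi_w p k t"

definition A_step :: "('nx::finite, 'nu::finite, 'Nu::finite, 'N::finite) ocp
    \<Rightarrow> nat \<Rightarrow> real^'nx^'nx" where
  "A_step p k = Phi_x p k (grid p (Suc k))"

definition B_step :: "('nx::finite, 'nu::finite, 'Nu::finite, 'N::finite) ocp
    \<Rightarrow> nat \<Rightarrow> real^('Nu \<times> 'nu)^'nx" where
  "B_step p k = Phi_u p k (grid p (Suc k))"

definition w_step :: "('nx::finite, 'nu::finite, 'Nu::finite, 'N::finite) ocp
    \<Rightarrow> nat \<Rightarrow> real^'nx" where
  "w_step p k = phi_w p k (grid p (Suc k))"

definition path_violation :: "('nx::finite, 'nu::finite, 'Nu::finite, 'N::finite) ocp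
    \<Rightarrow> nat \<Rightarrow> real^'nx \<Rightarrow> real^('Nu \<times> 'nu) \<Rightarrow> real" where
  "path_violation p k x U = integral {grid p k..grid p (Suc k)}
     (\<lambda>t. (\<Sum>i<n_g p. (pos_part (path_g p i t (state p k x U t) (control p U t)))\<^sup>2) +
          (\<Sum>i<n_h p. (path_h p i t (state p k x U t) (control p U t))\<^sup>2))"

definition stage_cost :: "('nx::finite, 'nu::finite, 'Nu::finite, 'N::finite) ocp
    \<Rightarrow> nat \<Rightarrow> real^'nx \<Rightarrow> real^('Nu \<times> 'nu) \<Rightarrow> real" where
  "stage_cost p k x U = integral {grid p k..grid p (Suc k)}
     (\<lambda>t. costY p t (state p k x U t) (control p U t))"

definition convex_ocp :: "('nx::finite, 'nu::finite, 'Nu::finite, 'N::finite) ocp \<Rightarrow> bool" where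
  "convex_ocp p \<longleftrightarrow>
     0 \<le> t_ini p \<and> t_ini p < t_fin p \<and> 0 < eps p \<and>
     C1_on ({0..} \<times> UNIV) (\<lambda>(t, x). costL p t x) \<and>
     C1_on ({0..} \<times> UNIV \<times> UNIV) (\<lambda>(t, x, u). costY p t x u) \<and>
     (\<forall>i<n_g p. C1_on ({0..} \<times> UNIV \<times> UNIV) (\<lambda>(t, x, u). path_g p i t x u)) \<and>
     (\<forall>i<n_h p. C1_on ({0..} \<times> UNIV \<times> UNIV) (\<lambda>(t, x, u). path_h p i t x u)) \<and>
     (\<forall>i<n_P p. C1_on ({0..} \<times> UNIV \<times> {0..} \<times> UNIV) (\<lambda>(s, x, t, y). bnd_P p i s x t y)) \<and>
     (\<forall>i<n_Q p. C1_on ({0..} \<times> UNIV \<times> {0..} \<times> UNIV) (\<lambda>(s, x, t, y). bnd_Q p i s x t y)) \<and>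
     convex_on UNIV (costL p (t_fin p)) \<and>
     (\<forall>t\<ge>0. convex_on UNIV (\<lambda>(x, u). costY p t x u)) \<and>
     (\<forall>i<n_g p. \<forall>t\<ge>0. convex_on UNIV (\<lambda>(x, u). path_g p i t x u)) \<and>
     (\<forall>i<n_h p. \<forall>t\<ge>0. affine_fun (\<lambda>(x, u). path_h p i t x u)) \<and>
     (\<forall>i<n_P p. convex_on UNIV (\<lambda>(x, y). bnd_P p i (t_ini p) x (t_fin p) y)) \<and>
     (\<forall>i<n_Q p. affine_fun (\<lambda>(x, y). bnd_Q p i (t_ini p) x (t_fin p) y)) \<and>
     (\<forall>j. piecewise_polynomial_on (t_ini p) (t_fin p) (\<lambda>t. Gamma_u p t $ j)) \<and>
     (\<forall>i<n_Uineq p. convex_on UNIV (U_ineq p i)) \<and>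
     (\<forall>j<n_Ueq p. affine_fun (U_eq p j)) \<and>
     compact (U_set p) \<and> convex (U_set p) \<and>
     bij_betw (node p) {1..CARD('N)} UNIV \<and>
     grid p 1 = t_ini p \<and> grid p CARD('N) = t_fin p \<and>
     strict_mono_on {1..CARD('N)} (grid p) \<and>
     (\<forall>k\<in>{1..<CARD('N)}.
        solves_ivp (\<lambda>t M. dynA p t ** M)
          (grid p k) (grid p (Suc k)) (mat 1) (Phi_x p k) \<and>
        solves_ivp (\<lambda>t M. dynA p t ** M + row_kron (Gamma_u p t) (dynB p t))
          (grid p k) (grid p (Suc k)) 0 (Phi_u p k) \<and>
        solves_ivp (\<lambda>t v. dynA p t *v v + dynw p t)
          (grid p k) (grid p (Suc k)) 0 (phi_w p k))"

section \<open>The discretized convex problem and its Lagrange multipliers\<close>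

definition cost :: "('nx::finite, 'nu::finite, 'Nu::finite, 'N::finite) ocp
    \<Rightarrow> ('nx, 'nu, 'Nu, 'N) decision \<Rightarrow> real" where
  "cost p = (\<lambda>(X, U). costL p (t_fin p) (X $ node p CARD('N)) +
     (\<Sum>k\<in>{1..<CARD('N)}. stage_cost p k (X $ node p k) U))"

definition Z_set :: "('nx::finite, 'nu::finite, 'Nu::finite, 'N::finite) ocp
    \<Rightarrow> ('nx, 'nu, 'Nu, 'N) decision set" where
  "Z_set p = {(X, U). U \<in> U_set p \<and>
     (\<forall>k\<in>{1..<CARD('N)}.
        X $ node p (Suc k) = A_step p k *v (X $ node p k) + B_step p k *v U + w_step p k) \<and>
     (\<forall>i<n_P p. bnd_P p i (t_ini p) (X $ node p 1) (t_fin p) (X $ node p CARD('N)) \<le> 0) \<and>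
     (\<forall>i<n_Q p. bnd_Q p i (t_ini p) (X $ node p 1) (t_fin p) (X $ node p CARD('N)) = 0)}"

definition cvx_feasible :: "('nx::finite, 'nu::finite, 'Nu::finite, 'N::finite) ocp
    \<Rightarrow> ('nx, 'nu, 'Nu, 'N) decision set" where
  "cvx_feasible p = {(X, U). (X, U) \<in> Z_set p \<and>
     (\<forall>k\<in>{1..<CARD('N)}. path_violation p k (X $ node p k) U \<le> eps p)}"

definition cvx_minimizers :: "('nx::finite, 'nu::finite, 'Nu::finite, 'N::finite) ocp
    \<Rightarrow> ('nx, 'nu, 'Nu, 'N) decision set" where
  "cvx_minimizers p = {z \<in> cvx_feasible p. \<forall>z'\<in>cvx_feasible p. cost p z \<le> cost p z'}"

text \<open>Every scalar constraint gets a label: an inequality constraint reads \<open>ineq_con p i z \<le> 0\<close>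
  and an equality constraint \<open>eq_con p j z = 0\<close>.\<close>

datatype ineq_label = Path nat | BndP nat | UIneq nat

datatype 'nx eq_label = Dyn nat 'nx | BndQ nat | UEq nat

definition ineq_labels :: "('nx::finite, 'nu::finite, 'Nu::finite, 'N::finite) ocp
    \<Rightarrow> ineq_label set" where
  "ineq_labels p = Path ` {1..<CARD('N)} \<union> BndP ` {..<n_P p} \<union> UIneq ` {..<n_Uineq p}"

definition eq_labels :: "('nx::finite, 'nu::finite, 'Nu::finite, 'N::finite) ocp
    \<Rightarrow> 'nx eq_label set" where
  "eq_labels p =
     (\<lambda>(k, i). Dyn k i) ` ({1..<CARD('N)} \<times> UNIV) \<union> BndQ ` {..<n_Q p} \<union> UEq ` {..<n_Ueq p}"

fun ineq_con :: "('nx::finite, 'nu::finite, 'Nu::finite, 'N::finite) ocp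
    \<Rightarrow> ineq_label \<Rightarrow> ('nx, 'nu, 'Nu, 'N) decision \<Rightarrow> real" where
  "ineq_con p (Path k) (X, U) = path_violation p k (X $ node p k) U - eps p"
| "ineq_con p (BndP i) (X, U) =
     bnd_P p i (t_ini p) (X $ node p 1) (t_fin p) (X $ node p CARD('N))"
| "ineq_con p (UIneq i) (X, U) = U_ineq p i U"

fun eq_con :: "('nx::finite, 'nu::finite, 'Nu::finite, 'N::finite) ocp
    \<Rightarrow> 'nx eq_label \<Rightarrow> ('nx, 'nu, 'Nu, 'N) decision \<Rightarrow> real" where
  "eq_con p (Dyn k i) (X, U) =
     (X $ node p (Suc k) - (A_step p k *v (X $ node p k) + B_step p k *v U + w_step p k)) $ i"
| "eq_con p (BndQ j) (X, U) =
     bnd_Q p j (t_ini p) (X $ node p 1) (t_fin p) (X $ node p CARD('N))"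
| "eq_con p (UEq j) (X, U) = U_eq p j U"

lemma cvx_feasible_iff_labels:
  "z \<in> cvx_feasible p \<longleftrightarrow>
     (\<forall>i\<in>ineq_labels p. ineq_con p i z \<le> 0) \<and> (\<forall>j\<in>eq_labels p. eq_con p j z = 0)"
  by (cases z)
    (auto simp: cvx_feasible_def Z_set_def U_set_def ineq_labels_def eq_labels_def
      ball_Un vec_eq_iff)

text \<open>The equality constraints are affine, so their gradients do not depend on the point.\<close>

definition strong_slater :: "('nx::finite, 'nu::finite, 'Nu::finite, 'N::finite) ocp \<Rightarrow> bool" where
  "strong_slater p \<longleftrightarrow>
     (\<forall>z. inj_on (\<lambda>j. gradient (eq_con p j) z) (eq_labels p) \<and>
          independent ((\<lambda>j. gradient (eq_con p j) z) ` eq_labels p)) \<and>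
     (\<exists>z. (\<forall>j\<in>eq_labels p. eq_con p j z = 0) \<and> (\<forall>i\<in>ineq_labels p. ineq_con p i z < 0))"

text \<open>The KKT conditions of a convex program. They are formulated with subdifferentials because
  the convex functions describing the control set need not be differentiable; at points of
  differentiability the subdifferential consists of the gradient only.\<close>

definition kkt :: "('nx::finite, 'nu::finite, 'Nu::finite, 'N::finite) ocp
    \<Rightarrow> ('nx, 'nu, 'Nu, 'N) decision \<Rightarrow> (ineq_label \<Rightarrow> real) \<Rightarrow> ('nx eq_label \<Rightarrow> real) \<Rightarrow> bool" where
  "kkt p z lam mu \<longleftrightarrow>
     z \<in> cvx_feasible p \<and>
     (\<forall>i\<in>ineq_labels p. 0 \<le> lam i \<and> lam i * ineq_con p i z = 0) \<and>
     (\<exists>s0 s. s0 \<in> subdifferential (\<lambda>y. ereal (cost p y)) z \<and>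
        (\<forall>i\<in>ineq_labels p. s i \<in> subdifferential (\<lambda>y. ereal (ineq_con p i y)) z) \<and>
        s0 + (\<Sum>i\<in>ineq_labels p. lam i *\<^sub>R s i) +
          (\<Sum>j\<in>eq_labels p. mu j *\<^sub>R gradient (eq_con p j) z) = 0)"

definition lagrange_multipliers :: "('nx::finite, 'nu::finite, 'Nu::finite, 'N::finite) ocp
    \<Rightarrow> real set" where
  "lagrange_multipliers p =
     {m. \<exists>z\<in>cvx_minimizers p. \<exists>lam mu. kkt p z lam mu \<and>
        (m \<in> lam ` ineq_labels p \<or> m \<in> mu ` eq_labels p)}"

section \<open>The penalized function\<close>

definition set_indicator :: "'a set \<Rightarrow> 'a \<Rightarrow> ereal" where
  "set_indicator S z = (if z \<in> S then 0 else \<infinity>)"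

definition Theta :: "('nx::finite, 'nu::finite, 'Nu::finite, 'N::finite) ocp
    \<Rightarrow> real \<Rightarrow> ('nx, 'nu, 'Nu, 'N) decision \<Rightarrow> ereal" where
  "Theta p \<gamma> z = ereal (cost p z) + set_indicator (Z_set p) z +
     ereal (\<gamma> * (\<Sum>k\<in>{1..<CARD('N)}.
       pos_part (path_violation p k (fst z $ node p k) (snd z) - eps p)))"

end

theory Submission
  imports Defs
begin

text \<open>
  Stationarity of \<open>\<Theta>\<^sub>\<gamma>\<close> at \<open>z\<close> means that \<open>z\<close> is a global minimizer of the cost plus \<open>\<gamma>\<close> times the
  total path violation over \<open>\<Z>\<close>, so the claim is exactness of an \<open>\<ell>\<^sub>1\<close>-type penalty. Let \<open>z\<close> be
  a minimizer of the constrained problem with multipliers \<open>\<lambda>\<close>, \<open>\<mu>\<close>. By convexity \<open>z\<close> minimizes the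
  Lagrangian (\<open>kkt_lagrangian_lower_bound\<close>), and on \<open>\<Z>\<close> only the path constraints can contribute
  positively to it. Since each of their multipliers lies strictly below \<open>\<gamma>\<close>, the penalty dominates
  this contribution, strictly so at points of \<open>\<Z>\<close> that violate a path constraint
  (\<open>penalized_cost_gap\<close>). Hence \<open>z\<close> minimizes the penalized cost, and every other minimizer of the
  penalized cost is feasible and has the same cost.

  This requires that multipliers exist at each minimizer: the hypothesis on \<open>\<gamma>\<close> says something about
  a minimizer only through its multipliers. Their existence has two ingredients.

  First, the KKT conditions for finite-valued convex functions under Slater's condition
  (\<open>convex_kkt_conditions\<close>). The constraints are moved into the objective one at a time. For a
  single constraint \<open>g\<close>, admissible multipliers are the numbers between two families of difference
  quotients, one from points with \<open>g > 0\<close> and one from points with \<open>g < 0\<close>; the families are ordered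
  because the segment between two such points meets the zero level of the chord of \<open>g\<close>. The
  resulting minimum of the Lagrangian is turned into a relation between subgradients of the
  individual functions by separating an epigraph from a hypograph (\<open>subgradient_split\<close>).

  Second, the discretized problem is convex. The state and the control are affine in the decision
  variable at every fixed time, so the integrands are convex in it, and integration preserves
  convexity once the integrands are known to be integrable (\<open>stage_integrand_integrable\<close>); the
  latter holds because they are piecewise continuous in time.
\<close>

section \<open>Multipliers for convex programs\<close>

lemma affine_fun_combination:
  assumes "affine_fun h" and "u + v = 1"
  shows "h (u *\<^sub>R x + v *\<^sub>R y) = u * h x + v * h y"
proof -
  obtain l c where l: "linear l" and h: "h = (\<lambda>x. l x + c)"
    using assms(1) unfolding affine_fun_def by blast
  have "c = u * c + v * c"
    using assms(2) by (metis distrib_right mult_1)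
  then show ?thesis
    by (simp add: h linear_add[OF l] linear_scale[OF l] algebra_simps)
qed

lemma affine_fun_imp_convex_on: "affine_fun h \<Longrightarrow> convex_on UNIV h"
  by (rule convex_onI) (simp_all add: affine_fun_combination)

lemma affine_fun_gradient:
  fixes h :: "'a::euclidean_space \<Rightarrow> real"
  assumes "affine_fun h"
  shows "h y = h z + gradient h z \<bullet> (y - z)"
proof -
  obtain l c where l: "linear l" and h: "h = (\<lambda>x. l x + c)"
    using assms unfolding affine_fun_def by blast
  define a where "a = adjoint l 1"
  have la: "l x = a \<bullet> x" for x
    using adjoint_works[OF l, of x 1] by (simp add: a_def inner_commute)
  have "GDERIV h z :> a"
    unfolding gderiv_def h la by (auto intro!: derivative_eq_intros simp: inner_commute)
  moreover have "D = a" if "GDERIV h z :> D" for D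
  proof -
    have "(\<lambda>y. y \<bullet> D) = (\<lambda>y. y \<bullet> a)"
      using that \<open>GDERIV h z :> a\<close> unfolding gderiv_def by (rule has_derivative_unique)
    then show ?thesis
      by (metis vector_eq_ldot)
  qed
  ultimately have "gradient h z = a"
    unfolding gradient_def by blast
  then show ?thesis
    by (simp add: h la inner_diff_right)
qed

lemma affine_fun_inner_diff:
  fixes a z :: "'a::real_inner"
  shows "affine_fun (\<lambda>y. a \<bullet> (y - z))"
  unfolding affine_fun_def
  by (intro exI[of _ "\<lambda>y. a \<bullet> y"] exI[of _ "- (a \<bullet> z)"])
    (auto simp: fun_eq_iff inner_diff_right inner_add_right intro!: linearI)

lemma convex_on_finite_sum:
  assumes "finite I" and "\<And>i. i \<in> I \<Longrightarrow> convex_on UNIV (f i)"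
  shows "convex_on UNIV (\<lambda>x. \<Sum>i\<in>I. f i x)"
  using assms by (induction I rule: finite_induct) (auto simp: convex_on_const)

lemma real_between_sets:
  fixes A B :: "real set"
  assumes "A \<noteq> {}" "B \<noteq> {}" "\<forall>a\<in>A. \<forall>b\<in>B. a \<le> b"
  shows "\<exists>m. (\<forall>a\<in>A. a \<le> m) \<and> (\<forall>b\<in>B. m \<le> b)"
proof (intro exI conjI ballI)
  have "bdd_above A"
    using assms(2,3) by (meson bdd_above.I ex_in_conv)
  then show "a \<le> Sup A" if "a \<in> A" for a
    using that by (rule cSup_upper[rotated])
  show "Sup A \<le> b" if "b \<in> B" for b
    using assms(1,3) that by (auto intro!: cSup_least)
qed

text \<open>The point of the segment from \<open>x\<close> to \<open>y\<close> at which the chord of \<open>g\<close> vanishes has objective value at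
  least \<open>v\<close> by hypothesis and at most the corresponding value of the chord of \<open>f\<close>; clearing
  denominators gives the inequality. The hypothesis is kept in this form because it covers both a
  convex inequality constraint, where \<open>g \<le> 0\<close> at that point, and an affine equality constraint, where
  \<open>g = 0\<close> there.\<close>

lemma crossing_slopes:
  fixes f g :: "'a::real_vector \<Rightarrow> real"
  assumes f: "convex_on C f" and g: "convex_on C g"
    and x: "x \<in> C" "0 < g x" and y: "y \<in> C" "g y < 0"
    and low: "\<And>u w. \<lbrakk>0 < u; 0 < w; u + w = 1; u * g x + w * g y = 0\<rbrakk>
      \<Longrightarrow> v \<le> f (u *\<^sub>R x + w *\<^sub>R y)"
  shows "(v - f x) / g x \<le> (f y - v) / (- g y)"
proof -
  define d where "d = g x - g y"
  define u where "u = - g y / d"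
  define w where "w = g x / d"
  have d: "d > 0" using x y by (simp add: d_def)
  have uw: "0 < u" "0 < w" using x y d by (auto simp: u_def w_def divide_neg_pos)
  have "u + w = (g x - g y) / d" by (simp add: u_def w_def diff_divide_distrib)
  then have uw1: "u + w = 1" using d by (simp add: d_def)
  have "u * g x + w * g y = 0" using d by (simp add: u_def w_def field_simps)
  then have "v \<le> f (u *\<^sub>R x + w *\<^sub>R y)" using low uw uw1 by blast
  also have "\<dots> \<le> u * f x + w * f y"
    using f uw uw1 x y unfolding convex_on_def by (simp add: less_imp_le)
  finally have "d * v \<le> d * (u * f x + w * f y)" using d by simp
  also have "\<dots> = (- g y) * f x + g x * f y"
    using d by (simp add: u_def w_def field_simps)
  finally have "d * v \<le> (- g y) * f x + g x * f y" .
  then show ?thesis using x y by (simp add: d_def field_simps)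
qed

lemma lagrangian_bound_of_slopes:
  fixes fy gy m v :: real
  assumes "0 < gy \<Longrightarrow> (v - fy) / gy \<le> m" and "gy < 0 \<Longrightarrow> m \<le> (fy - v) / (- gy)"
    and "gy = 0 \<Longrightarrow> v \<le> fy"
  shows "v \<le> fy + m * gy"
  using assms by (cases gy "0 :: real" rule: linorder_cases) (simp_all add: field_simps)

text \<open>A multiplier has to lie above all slopes \<open>(v - f y) / g y\<close> at violating points and
  below all slopes \<open>(f y - v) / (- g y)\<close> at strictly feasible points. The Slater point keeps the second
  family nonempty, so the least upper bound of the first is finite.\<close>

lemma multiplier_of_convex_constraint:
  fixes f g :: "'a::real_vector \<Rightarrow> real"
  assumes f: "convex_on C f" and g: "convex_on C g"
    and z0: "z0 \<in> C" "g z0 < 0"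
    and low: "\<And>y. y \<in> C \<Longrightarrow> g y \<le> 0 \<Longrightarrow> v \<le> f y"
  obtains m where "0 \<le> m" "\<And>y. y \<in> C \<Longrightarrow> v \<le> f y + m * g y"
proof -
  \<comment> \<open>The element 0 makes the multiplier nonnegative; it lies below \<open>?B\<close> since \<open>f \<ge> v\<close> where \<open>g < 0\<close>.\<close>
  let ?A = "insert 0 ((\<lambda>y. (v - f y) / g y) ` {y \<in> C. 0 < g y})"
  let ?B = "(\<lambda>y. (f y - v) / (- g y)) ` {y \<in> C. g y < 0}"
  have C: "convex C" using f by (simp add: convex_on_def)
  have cross: "(v - f x) / g x \<le> (f y - v) / (- g y)"
    if "x \<in> C" "0 < g x" "y \<in> C" "g y < 0" for x y
  proof (rule crossing_slopes[OF f g that])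
    fix u w :: real
    assume uw: "0 < u" "0 < w" "u + w = 1" "u * g x + w * g y = 0"
    have "g (u *\<^sub>R x + w *\<^sub>R y) \<le> u * g x + w * g y"
      using g uw(1-3) that unfolding convex_on_def by (simp add: less_imp_le)
    moreover have "u *\<^sub>R x + w *\<^sub>R y \<in> C"
      using C uw that by (simp add: convexD)
    ultimately show "v \<le> f (u *\<^sub>R x + w *\<^sub>R y)" using low uw by simp
  qed
  have le: "\<forall>a\<in>?A. \<forall>b\<in>?B. a \<le> b"
  proof -
    have "0 \<le> (f y - v) / (- g y)" if "y \<in> C" "g y < 0" for y
      using low[of y] that by (simp add: divide_nonneg_neg)
    then show ?thesis using cross by blast
  qed
  have ne: "?A \<noteq> {}" "?B \<noteq> {}" using z0 by auto
  obtain m where m: "\<forall>a\<in>?A. a \<le> m" "\<forall>b\<in>?B. m \<le> b"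
    using real_between_sets[OF ne le] by (elim exE conjE) (rule that)
  show ?thesis
  proof
    show "0 \<le> m" using m(1) by blast
    fix y assume y: "y \<in> C"
    show "v \<le> f y + m * g y"
    proof (rule lagrangian_bound_of_slopes)
      show "(v - f y) / g y \<le> m" if "0 < g y" using m(1) y that by blast
      show "m \<le> (f y - v) / (- g y)" if "g y < 0" using m(2) y that by blast
      show "v \<le> f y" if "g y = 0" using low y that by simp
    qed
  qed
qed

text \<open>One constraint is eliminated on the set cut out by the others, and its term joins the objective
  before the next elimination; hence the induction ranges over all objectives.\<close>

lemma multipliers_of_convex_constraints:
  fixes f :: "'a::real_vector \<Rightarrow> real"
  assumes "finite I" and "convex_on C f" and "\<And>i. i \<in> I \<Longrightarrow> convex_on C (g i)"
    and "z0 \<in> C" and "\<And>i. i \<in> I \<Longrightarrow> g i z0 < 0"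
    and "\<And>y. y \<in> C \<Longrightarrow> (\<And>i. i \<in> I \<Longrightarrow> g i y \<le> 0) \<Longrightarrow> v \<le> f y"
  shows "\<exists>lam. (\<forall>i\<in>I. 0 \<le> lam i) \<and> (\<forall>y\<in>C. v \<le> f y + (\<Sum>i\<in>I. lam i * g i y))"
  using assms
proof (induction I arbitrary: f rule: finite_induct)
  case empty
  then show ?case by simp
next
  case (insert a I)
  define D where "D = {y \<in> C. \<forall>i\<in>I. g i y \<le> 0}"
  have C: "convex C" using insert.prems(1) by (simp add: convex_on_def)
  have D: "convex D"
  proof (rule convexI)
    fix x y and u w :: real
    assume *: "x \<in> D" "y \<in> D" "0 \<le> u" "0 \<le> w" "u + w = 1"
    have "g i (u *\<^sub>R x + w *\<^sub>R y) \<le> 0" if "i \<in> I" for i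
    proof -
      have "g i (u *\<^sub>R x + w *\<^sub>R y) \<le> u * g i x + w * g i y"
        using insert.prems(2)[of i] * that unfolding convex_on_def D_def by simp
      also have "\<dots> \<le> 0"
        using * that unfolding D_def by (simp add: add_nonpos_nonpos mult_nonneg_nonpos)
      finally show ?thesis .
    qed
    then show "u *\<^sub>R x + w *\<^sub>R y \<in> D"
      using * C unfolding D_def by (simp add: convexD)
  qed
  have sub: "D \<subseteq> C" by (auto simp: D_def)
  have fD: "convex_on D f" and gD: "convex_on D (g a)"
    using insert.prems(1,2) sub D by (auto intro: convex_on_subset)
  obtain m where m: "0 \<le> m" "\<And>y. y \<in> D \<Longrightarrow> v \<le> f y + m * g a y"
  proof (rule multiplier_of_convex_constraint[OF fD gD, of z0 v])
    show "z0 \<in> D" using insert.prems(3,4) by (auto simp: D_def less_imp_le)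
    show "g a z0 < 0" using insert.prems(4) by simp
    show "v \<le> f y" if "y \<in> D" "g a y \<le> 0" for y
      using insert.prems(5)[of y] that by (auto simp: D_def)
  qed blast
  have "\<exists>lam. (\<forall>i\<in>I. 0 \<le> lam i) \<and>
      (\<forall>y\<in>C. v \<le> (f y + m * g a y) + (\<Sum>i\<in>I. lam i * g i y))"
  proof (rule insert.IH)
    show "convex_on C (\<lambda>y. f y + m * g a y)"
      using insert.prems(1,2) m(1) by (intro convex_on_add convex_on_cmul) auto
    show "v \<le> f y + m * g a y" if "y \<in> C" "\<And>i. i \<in> I \<Longrightarrow> g i y \<le> 0" for y
      using m(2) that by (auto simp: D_def)
  qed (use insert.prems in auto)
  then obtain lam where lam: "\<forall>i\<in>I. 0 \<le> lam i"
      "\<forall>y\<in>C. v \<le> (f y + m * g a y) + (\<Sum>i\<in>I. lam i * g i y)"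
    by blast
  have "(\<Sum>i\<in>I. (lam(a := m)) i * g i y) = (\<Sum>i\<in>I. lam i * g i y)" for y
    using insert.hyps by (intro sum.cong) auto
  then have "(\<Sum>i\<in>insert a I. (lam(a := m)) i * g i y)
      = m * g a y + (\<Sum>i\<in>I. lam i * g i y)" for y
    using insert.hyps by simp
  then show ?case
    using lam m(1) by (intro exI[of _ "lam(a := m)"]) (auto simp: add.assoc)
qed

text \<open>No strictly feasible point is available here. Its role is taken by reflection at \<open>z0\<close>: on an affine
  set, an affine function that vanishes at one point either vanishes identically or takes both
  signs.\<close>

lemma multiplier_of_affine_constraint:
  fixes f h :: "'a::real_vector \<Rightarrow> real"
  assumes f: "convex_on C f" and h: "affine_fun h" and C: "affine C"
    and z0: "z0 \<in> C" "h z0 = 0"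
    and low: "\<And>y. y \<in> C \<Longrightarrow> h y = 0 \<Longrightarrow> v \<le> f y"
  obtains m where "\<And>y. y \<in> C \<Longrightarrow> v \<le> f y + m * h y"
proof (cases "\<forall>y\<in>C. h y = 0")
  case True
  then show ?thesis using low that[of 0] by simp
next
  case False
  let ?A = "(\<lambda>y. (v - f y) / h y) ` {y \<in> C. 0 < h y}"
  let ?B = "(\<lambda>y. (f y - v) / (- h y)) ` {y \<in> C. h y < 0}"
  have hC: "convex_on C h"
    using affine_fun_imp_convex_on[OF h] f
    by (meson convex_on_subset convex_on_imp_convex subset_UNIV)
  have refl: "2 *\<^sub>R z0 + (-1) *\<^sub>R y \<in> C" if "y \<in> C" for y
    using mem_affine[OF C z0(1) that, of 2 "-1"] by simp
  have hrefl: "h (2 *\<^sub>R z0 + (-1) *\<^sub>R y) = - h y" for y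
    using affine_fun_combination[OF h, of 2 "-1" z0 y] z0 by simp
  obtain y0 where "y0 \<in> C" "h y0 \<noteq> 0" using False by blast
  then have "(\<exists>y\<in>C. 0 < h y) \<and> (\<exists>y\<in>C. h y < 0)"
    using refl[of y0] hrefl[of y0]
    by (metis linorder_neqE neg_0_less_iff_less neg_less_0_iff_less)
  then have ne: "?A \<noteq> {}" "?B \<noteq> {}" by auto
  have cross: "(v - f x) / h x \<le> (f y - v) / (- h y)"
    if "x \<in> C" "0 < h x" "y \<in> C" "h y < 0" for x y
  proof (rule crossing_slopes[OF f hC that])
    fix u w :: real
    assume uw: "0 < u" "0 < w" "u + w = 1" "u * h x + w * h y = 0"
    then show "v \<le> f (u *\<^sub>R x + w *\<^sub>R y)"
      using low C that affine_fun_combination[OF h] by (simp add: affine_def)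
  qed
  have le: "\<forall>a\<in>?A. \<forall>b\<in>?B. a \<le> b"
    using cross by blast
  obtain m where m: "\<forall>a\<in>?A. a \<le> m" "\<forall>b\<in>?B. m \<le> b"
    using real_between_sets[OF ne le] by (elim exE conjE) (rule that)
  show ?thesis
  proof (rule that)
    fix y assume y: "y \<in> C"
    show "v \<le> f y + m * h y"
    proof (rule lagrangian_bound_of_slopes)
      show "(v - f y) / h y \<le> m" if "0 < h y" using m(1) y that by blast
      show "m \<le> (f y - v) / (- h y)" if "h y < 0" using m(2) y that by blast
      show "v \<le> f y" if "h y = 0" using low y that by simp
    qed
  qed
qed

lemma affine_zero_set:
  assumes "\<And>j. j \<in> J \<Longrightarrow> affine_fun (h j)"
  shows "affine {y. \<forall>j\<in>J. h j y = 0}"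
  using assms by (auto simp: affine_def affine_fun_combination)

lemma multipliers_of_affine_constraints:
  fixes f :: "'a::real_vector \<Rightarrow> real"
  assumes "finite J" and "convex_on UNIV f" and "\<And>j. j \<in> J \<Longrightarrow> affine_fun (h j)"
    and "\<And>j. j \<in> J \<Longrightarrow> h j z0 = 0"
    and "\<And>y. (\<And>j. j \<in> J \<Longrightarrow> h j y = 0) \<Longrightarrow> v \<le> f y"
  shows "\<exists>mu. \<forall>y. v \<le> f y + (\<Sum>j\<in>J. mu j * h j y)"
  using assms
proof (induction J arbitrary: f rule: finite_induct)
  case empty
  then show ?case by simp
next
  case (insert a J)
  let ?D = "{y. \<forall>j\<in>J. h j y = 0}"
  have D: "affine ?D" using insert.prems(2) by (intro affine_zero_set) auto
  have fD: "convex_on ?D f"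
    using insert.prems(1) subset_UNIV affine_imp_convex[OF D] by (rule convex_on_subset)
  have ha: "affine_fun (h a)" using insert.prems(2) by simp
  obtain m where m: "\<And>y. y \<in> ?D \<Longrightarrow> v \<le> f y + m * h a y"
  proof (rule multiplier_of_affine_constraint[OF fD ha D, of z0 v])
    show "z0 \<in> ?D" "h a z0 = 0" using insert.prems(3) by auto
    show "v \<le> f y" if "y \<in> ?D" "h a y = 0" for y
      using insert.prems(4)[of y] that by auto
  qed blast
  have "convex_on UNIV (\<lambda>y. m * h a y)"
    by (simp add: convex_on_def affine_fun_combination[OF ha] distrib_left mult.left_commute)
  then have "\<exists>mu. \<forall>y. v \<le> (f y + m * h a y) + (\<Sum>j\<in>J. mu j * h j y)"
    using insert.prems m by (intro insert.IH convex_on_add) auto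
  then obtain mu where mu: "\<forall>y. v \<le> (f y + m * h a y) + (\<Sum>j\<in>J. mu j * h j y)"
    by blast
  have "(\<Sum>j\<in>J. (mu(a := m)) j * h j y) = (\<Sum>j\<in>J. mu j * h j y)" for y
    using insert.hyps by (intro sum.cong) auto
  then have "(\<Sum>j\<in>insert a J. (mu(a := m)) j * h j y)
      = m * h a y + (\<Sum>j\<in>J. mu j * h j y)" for y
    using insert.hyps by simp
  then show ?case
    using mu by (intro exI[of _ "mu(a := m)"]) (auto simp: add.assoc)
qed

section \<open>Subgradients of sums\<close>

text \<open>The sum rule for subdifferentials in the form needed: the strict epigraph of \<open>f - f z\<close> and the
  hypograph of \<open>g z - g\<close> are disjoint, and \<open>s\<close> is the slope of a separating hyperplane. The hyperplane
  is not vertical because \<open>f\<close> is finite on the whole space. Allowing a set \<open>C\<close> for \<open>g\<close> makes the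
  existence of subgradients the special case \<open>C = {z}\<close>.\<close>

lemma subgradient_split:
  fixes f g :: "'a::euclidean_space \<Rightarrow> real"
  assumes f: "convex_on UNIV f" and g: "convex_on C g" and z: "z \<in> C"
    and min: "\<And>y. y \<in> C \<Longrightarrow> f z + g z \<le> f y + g y"
  obtains s where "\<And>y. f z + s \<bullet> (y - z) \<le> f y"
    and "\<And>y. y \<in> C \<Longrightarrow> g z - s \<bullet> (y - z) \<le> g y"
proof -
  let ?S = "{(y, r). f y - f z < r}"
  let ?T = "{(y, r). y \<in> C \<and> r \<le> g z - g y}"
  have C: "convex C" using g by (simp add: convex_on_def)
  have S: "convex ?S"
  proof (rule convexI, clarsimp)
    fix x y :: 'a and r s u w :: real
    assume *: "f x - f z < r" "f y - f z < s" "0 \<le> u" "0 \<le> w" "u + w = 1"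
    have "f (u *\<^sub>R x + w *\<^sub>R y) \<le> u * f x + w * f y"
      using f * by (simp add: convex_on_def)
    moreover have "u * (f x - f z - r) + w * (f y - f z - s) < 0"
    proof (cases "u = 0")
      case False
      then have "u * (f x - f z - r) < 0" "w * (f y - f z - s) \<le> 0"
        using * by (auto simp: mult_less_0_iff mult_le_0_iff)
      then show ?thesis by linarith
    qed (use * in auto)
    moreover have "u * f z + w * f z = f z" using * by (metis distrib_right mult_1)
    ultimately show "f (u *\<^sub>R x + w *\<^sub>R y) - f z < u * r + w * s"
      by (simp add: algebra_simps)
  qed
  have T: "convex ?T"
  proof (rule convexI, clarsimp)
    fix x y :: 'a and r s u w :: real
    assume *: "x \<in> C" "r \<le> g z - g x" "y \<in> C" "s \<le> g z - g y" "0 \<le> u" "0 \<le> w" "u + w = 1"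
    have "g (u *\<^sub>R x + w *\<^sub>R y) \<le> u * g x + w * g y"
      using g * by (simp add: convex_on_def)
    moreover have "u * r \<le> u * (g z - g x)" "w * s \<le> w * (g z - g y)"
      using * by (auto intro: mult_left_mono)
    moreover have "u * g z + w * g z = g z" using * by (metis distrib_right mult_1)
    ultimately show "u *\<^sub>R x + w *\<^sub>R y \<in> C \<and> u * r + w * s \<le> g z - g (u *\<^sub>R x + w *\<^sub>R y)"
      using C * by (simp add: algebra_simps convexD)
  qed
  have "(z, 1) \<in> ?S" "(z, 0) \<in> ?T" using z by auto
  then have ne: "?S \<noteq> {}" "?T \<noteq> {}" by blast+
  have dis: "?S \<inter> ?T = {}" using min by fastforce
  obtain n c where n: "n \<noteq> 0" "\<forall>x\<in>?S. n \<bullet> x \<le> c" "\<forall>x\<in>?T. n \<bullet> x \<ge> c"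
    using separating_hyperplane_sets[OF S T ne dis] by blast
  obtain a b where ab: "n = (a, b)" by (cases n)
  have nS: "a \<bullet> y + b * r \<le> c" if "f y - f z < r" for y r
    using n(2) that by (auto simp: ab inner_prod_def)
  have nT: "c \<le> a \<bullet> y + b * r" if "y \<in> C" "r \<le> g z - g y" for y r
    using n(3) that by (auto simp: ab inner_prod_def)
  \<comment> \<open>The strict epigraph is replaced by its closure: \<open>r\<close> tends to \<open>f y - f z\<close>.\<close>
  have nS': "a \<bullet> y + b * (f y - f z) \<le> c" for y
  proof (rule field_le_epsilon)
    fix e :: real assume e: "0 < e"
    define d where "d = e / (\<bar>b\<bar> + 1)"
    have "d > 0" using e by (simp add: d_def)
    then have "a \<bullet> y + b * (f y - f z + d) \<le> c" by (intro nS) auto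
    moreover have "- (b * d) \<le> e"
    proof -
      have "- (b * d) \<le> (\<bar>b\<bar> + 1) * d" using \<open>d > 0\<close>
        by (metis abs_ge_minus_self add_increasing2 less_imp_le minus_mult_left mult_right_mono zero_le_one)
      then show ?thesis by (simp add: d_def)
    qed
    ultimately show "a \<bullet> y + b * (f y - f z) \<le> c + e" by (simp add: algebra_simps)
  qed
  have az: "a \<bullet> z = c" using nS'[of z] nT[of z 0] z by simp
  have "b \<le> 0" using nS[of z 1] az by simp
  moreover have "b \<noteq> 0"
  proof
    assume b: "b = 0"
    \<comment> \<open>A vertical hyperplane would bound a linear functional on the whole space by its value at \<open>z\<close>.\<close>
    then have "a \<bullet> (z + a) \<le> c" using nS'[of "z + a"] by simp
    then have "a \<bullet> a \<le> 0" using az by (simp add: inner_add_right)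
    then have "a = 0" using inner_gt_zero_iff[of a] by linarith
    then show False using n(1) ab b by (simp add: zero_prod_def)
  qed
  ultimately have b: "b < 0" by simp
  define s where "s = (- 1 / b) *\<^sub>R a"
  have s: "s \<bullet> (y - z) = (c - a \<bullet> y) / b" for y
    using b by (simp add: s_def inner_diff_right az field_simps)
  show ?thesis
  proof
    show "f z + s \<bullet> (y - z) \<le> f y" for y
      using nS'[of y] b by (simp add: s field_simps)
    show "g z - s \<bullet> (y - z) \<le> g y" if "y \<in> C" for y
      using nT[of y "g z - g y"] that b by (simp add: s field_simps)
  qed
qed

lemma subdifferential_real_iff:
  "s \<in> subdifferential (\<lambda>y. ereal (f y)) z \<longleftrightarrow> (\<forall>y. f z + s \<bullet> (y - z) \<le> f y)"
  by (simp add: subdifferential_def)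

lemma subdifferential_convex_nonempty:
  fixes f :: "'a::euclidean_space \<Rightarrow> real"
  assumes "convex_on UNIV f"
  shows "subdifferential (\<lambda>y. ereal (f y)) z \<noteq> {}"
proof -
  obtain s where "\<And>y. f z + s \<bullet> (y - z) \<le> f y"
  proof (rule subgradient_split[OF assms, of "{z}" "\<lambda>_. 0" z])
    show "convex_on {z} (\<lambda>_. 0 :: real)" by (simp add: convex_on_def)
  qed auto
  then have "s \<in> subdifferential (\<lambda>y. ereal (f y)) z" by (simp add: subdifferential_real_iff)
  then show ?thesis by blast
qed

text \<open>The induction splits off one summand at a time and so again ranges over all \<open>f\<close>. A weight may be
  zero; then the subgradient of that summand is arbitrary, and it has to be supplied separately.\<close>

lemma subgradients_of_weighted_sum:
  fixes f :: "'a::euclidean_space \<Rightarrow> real"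
  assumes "finite I" and "convex_on UNIV f" and "\<And>i. i \<in> I \<Longrightarrow> convex_on UNIV (g i)"
    and "\<And>i. i \<in> I \<Longrightarrow> 0 \<le> lam i"
    and "\<And>y. f z + (\<Sum>i\<in>I. lam i * g i z) \<le> f y + (\<Sum>i\<in>I. lam i * g i y)"
  shows "\<exists>s0 s. s0 \<in> subdifferential (\<lambda>y. ereal (f y)) z \<and>
    (\<forall>i\<in>I. s i \<in> subdifferential (\<lambda>y. ereal (g i y)) z) \<and> s0 + (\<Sum>i\<in>I. lam i *\<^sub>R s i) = 0"
  using assms
proof (induction I arbitrary: f rule: finite_induct)
  case empty
  then show ?case
    by (intro exI[of _ 0]) (simp add: subdifferential_real_iff)
next
  case (insert a I)
  have ga: "convex_on UNIV (g a)" and la: "0 \<le> lam a" using insert.prems(2,3) by auto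
  have "\<exists>s0 s. s0 \<in> subdifferential (\<lambda>y. ereal (f y + lam a * g a y)) z \<and>
    (\<forall>i\<in>I. s i \<in> subdifferential (\<lambda>y. ereal (g i y)) z) \<and> s0 + (\<Sum>i\<in>I. lam i *\<^sub>R s i) = 0"
    using insert.prems insert.hyps
    by (intro insert.IH convex_on_add convex_on_cmul) (auto simp: add.assoc)
  then obtain t s where t: "\<And>y. f z + lam a * g a z + t \<bullet> (y - z) \<le> f y + lam a * g a y"
    and s: "\<forall>i\<in>I. s i \<in> subdifferential (\<lambda>y. ereal (g i y)) z"
    and ts: "t + (\<Sum>i\<in>I. lam i *\<^sub>R s i) = 0"
    by (auto simp: subdifferential_real_iff)
  have lin: "affine_fun (\<lambda>y. - (t \<bullet> (y - z)))"
    using affine_fun_inner_diff[of "- t" z] by simp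
  \<comment> \<open>After subtracting \<open>t \<bullet> (y - z)\<close>, the sum \<open>f y + lam a * g a y\<close> is minimal at \<open>z\<close> and can be split.\<close>
  obtain r where r1: "\<And>y. f z + r \<bullet> (y - z) \<le> f y"
    and r2: "\<And>y. lam a * g a z - r \<bullet> (y - z) \<le> lam a * g a y + - (t \<bullet> (y - z))"
  proof (rule subgradient_split[OF insert.prems(1), of UNIV "\<lambda>y. lam a * g a y + - (t \<bullet> (y - z))" z])
    show "convex_on UNIV (\<lambda>y. lam a * g a y + - (t \<bullet> (y - z)))"
      using ga la affine_fun_imp_convex_on[OF lin] by (intro convex_on_add convex_on_cmul) auto
    show "f z + (lam a * g a z + - (t \<bullet> (z - z))) \<le> f y + (lam a * g a y + - (t \<bullet> (y - z)))" for y
      using t[of y] by simp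
  qed auto
  have "\<exists>q. q \<in> subdifferential (\<lambda>y. ereal (g a y)) z \<and> lam a *\<^sub>R q = t - r"
  proof (cases "lam a = 0")
    case True
    have "(t - r) \<bullet> (t - r) \<le> 0"
      using r2[of "z + (t - r)"] True by (simp add: inner_diff_left)
    then have "t - r = 0" using inner_gt_zero_iff[of "t - r"] by linarith
    then show ?thesis using subdifferential_convex_nonempty[OF ga, of z] True by auto
  next
    case False
    then have pos: "0 < lam a" using la by simp
    define q where "q = (1 / lam a) *\<^sub>R (t - r)"
    have q: "lam a *\<^sub>R q = t - r" using pos by (simp add: q_def)
    have "g a z + q \<bullet> (y - z) \<le> g a y" for y
    proof -
      have "lam a * (q \<bullet> (y - z)) = (t - r) \<bullet> (y - z)"
        by (metis q inner_scaleR_left)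
      then have "lam a * (g a z + q \<bullet> (y - z)) \<le> lam a * g a y"
        using r2[of y] by (simp add: inner_diff_left distrib_left)
      then show ?thesis using pos by simp
    qed
    then show ?thesis using q by (auto simp: subdifferential_real_iff)
  qed
  then obtain q where q: "q \<in> subdifferential (\<lambda>y. ereal (g a y)) z" "lam a *\<^sub>R q = t - r"
    by blast
  have "(\<Sum>i\<in>I. lam i *\<^sub>R (s(a := q)) i) = (\<Sum>i\<in>I. lam i *\<^sub>R s i)"
    using insert.hyps by (intro sum.cong) auto
  then have "r + (\<Sum>i\<in>insert a I. lam i *\<^sub>R (s(a := q)) i) = 0"
    using insert.hyps q ts by simp
  then show ?case
    using r1 s q(1)
    by (intro exI[of _ r] exI[of _ "s(a := q)"]) (auto simp: subdifferential_real_iff)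
qed

text \<open>The inequality constraints are removed first, on the affine set given by the equalities, since
  the Slater point is strictly feasible only there. The equalities follow and leave a Lagrangian
  that is minimal at \<open>z\<close> over the whole space, so that the sum rule applies.\<close>

lemma convex_kkt_conditions:
  fixes f :: "'a::euclidean_space \<Rightarrow> real"
  assumes I: "finite I" and J: "finite J"
    and f: "convex_on UNIV f" and g: "\<And>i. i \<in> I \<Longrightarrow> convex_on UNIV (g i)"
    and h: "\<And>j. j \<in> J \<Longrightarrow> affine_fun (h j)"
    and slater: "\<And>i. i \<in> I \<Longrightarrow> g i z0 < 0" "\<And>j. j \<in> J \<Longrightarrow> h j z0 = 0"
    and feas: "\<And>i. i \<in> I \<Longrightarrow> g i z \<le> 0" "\<And>j. j \<in> J \<Longrightarrow> h j z = 0"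
    and min: "\<And>y. (\<And>i. i \<in> I \<Longrightarrow> g i y \<le> 0) \<Longrightarrow> (\<And>j. j \<in> J \<Longrightarrow> h j y = 0) \<Longrightarrow> f z \<le> f y"
  obtains lam mu s0 s where "\<And>i. i \<in> I \<Longrightarrow> 0 \<le> lam i" "\<And>i. i \<in> I \<Longrightarrow> lam i * g i z = 0"
    "s0 \<in> subdifferential (\<lambda>y. ereal (f y)) z"
    "\<And>i. i \<in> I \<Longrightarrow> s i \<in> subdifferential (\<lambda>y. ereal (g i y)) z"
    "s0 + (\<Sum>i\<in>I. lam i *\<^sub>R s i) + (\<Sum>j\<in>J. mu j *\<^sub>R gradient (h j) z) = 0"
proof -
  let ?C = "{y. \<forall>j\<in>J. h j y = 0}"
  have C: "convex ?C" using h by (intro affine_imp_convex affine_zero_set) auto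
  have "\<exists>lam. (\<forall>i\<in>I. 0 \<le> lam i) \<and> (\<forall>y\<in>?C. f z \<le> f y + (\<Sum>i\<in>I. lam i * g i y))"
  proof (rule multipliers_of_convex_constraints[OF I])
    show "convex_on ?C f" using f subset_UNIV C by (rule convex_on_subset)
    show "convex_on ?C (g i)" if "i \<in> I" for i using g[OF that] subset_UNIV C by (rule convex_on_subset)
    show "z0 \<in> ?C" using slater by simp
  qed (use slater min in auto)
  then obtain lam where lam: "\<And>i. i \<in> I \<Longrightarrow> 0 \<le> lam i"
    and C_low: "\<And>y. y \<in> ?C \<Longrightarrow> f z \<le> f y + (\<Sum>i\<in>I. lam i * g i y)" by blast
  have term_le: "lam i * g i z \<le> 0" if "i \<in> I" for i
    using lam feas(1) that by (simp add: mult_nonneg_nonpos)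
  have "(\<Sum>i\<in>I. lam i * g i z) \<le> 0" using term_le by (rule sum_nonpos)
  moreover have "0 \<le> (\<Sum>i\<in>I. lam i * g i z)" using C_low[of z] feas(2) by simp
  ultimately have sum0: "(\<Sum>i\<in>I. lam i * g i z) = 0" by simp
  have comp: "lam i * g i z = 0" if "i \<in> I" for i
    using sum_nonneg_eq_0_iff[OF I, of "\<lambda>i. - (lam i * g i z)"] term_le sum0 that
    by (simp add: sum_negf)
  let ?F = "\<lambda>y. f y + (\<Sum>i\<in>I. lam i * g i y)"
  have F: "convex_on UNIV ?F"
    using f g lam I by (intro convex_on_add convex_on_finite_sum convex_on_cmul)
  obtain mu where mu: "\<And>y. f z \<le> ?F y + (\<Sum>j\<in>J. mu j * h j y)"
    using multipliers_of_affine_constraints[of J ?F h z0 "f z", OF J F h slater(2)] C_low by auto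
  define n where "n = (\<Sum>j\<in>J. mu j *\<^sub>R gradient (h j) z)"
  have hn: "(\<Sum>j\<in>J. mu j * h j y) = n \<bullet> (y - z)" for y
    unfolding n_def inner_sum_left
    using affine_fun_gradient[OF h, of _ y z] feas(2) by (intro sum.cong) auto
  have "\<exists>s0 s. s0 \<in> subdifferential (\<lambda>y. ereal (f y + n \<bullet> (y - z))) z \<and>
    (\<forall>i\<in>I. s i \<in> subdifferential (\<lambda>y. ereal (g i y)) z) \<and> s0 + (\<Sum>i\<in>I. lam i *\<^sub>R s i) = 0"
  proof (rule subgradients_of_weighted_sum[OF I])
    show "convex_on UNIV (\<lambda>y. f y + n \<bullet> (y - z))"
      using f affine_fun_imp_convex_on[OF affine_fun_inner_diff] by (rule convex_on_add)
    show "f z + n \<bullet> (z - z) + (\<Sum>i\<in>I. lam i * g i z)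
        \<le> f y + n \<bullet> (y - z) + (\<Sum>i\<in>I. lam i * g i y)" for y
      using mu[of y] by (simp add: hn sum0)
  qed (use g lam in auto)
  then obtain t s where t: "\<And>y. f z + t \<bullet> (y - z) \<le> f y + n \<bullet> (y - z)"
    and s: "\<forall>i\<in>I. s i \<in> subdifferential (\<lambda>y. ereal (g i y)) z"
    and ts: "t + (\<Sum>i\<in>I. lam i *\<^sub>R s i) = 0"
    by (auto simp: subdifferential_real_iff)
  have "t - n \<in> subdifferential (\<lambda>y. ereal (f y)) z"
    unfolding subdifferential_real_iff
  proof
    show "f z + (t - n) \<bullet> (y - z) \<le> f y" for y
      using t[of y] by (simp add: inner_diff_left)
  qed
  moreover have "t - n + (\<Sum>i\<in>I. lam i *\<^sub>R s i) + (\<Sum>j\<in>J. mu j *\<^sub>R gradient (h j) z) = 0"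
    using ts by (simp add: n_def[symmetric])
  ultimately show ?thesis using that lam comp s by blast
qed

section \<open>The discretized problem is convex\<close>

lemma convex_on_compose_linear:
  "convex_on UNIV f \<Longrightarrow> linear l \<Longrightarrow> convex_on UNIV (\<lambda>z. f (l z))"
  by (simp add: convex_on_def linear_add linear_scale)

lemma affine_fun_compose_linear:
  assumes "affine_fun h" and "linear l"
  shows "affine_fun (\<lambda>z. h (l z))"
proof -
  obtain m c where "linear m" "h = (\<lambda>x. m x + c)"
    using assms(1) unfolding affine_fun_def by blast
  then show ?thesis
    unfolding affine_fun_def
    using linear_compose[OF assms(2)] by (intro exI[of _ "m \<circ> l"] exI[of _ c]) auto
qed

lemma C1_on_imp_continuous_on: "C1_on S f \<Longrightarrow> continuous_on S f"
  unfolding C1_on_def continuous_on_eq_continuous_within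
  by (meson has_derivative_continuous)

lemma convex_on_square_pos_part:
  assumes "convex_on UNIV f"
  shows "convex_on UNIV (\<lambda>x. (pos_part (f x))\<^sup>2)"
  unfolding convex_on_def
proof (intro conjI convex_UNIV ballI allI impI)
  fix x y and u w :: real
  assume uw: "0 \<le> u" "0 \<le> w" "u + w = 1"
  have "f (u *\<^sub>R x + w *\<^sub>R y) \<le> u * f x + w * f y"
    using assms uw by (simp add: convex_on_def)
  also have "\<dots> \<le> u * pos_part (f x) + w * pos_part (f y)"
    using uw by (intro add_mono mult_left_mono) (auto simp: pos_part_def)
  finally have "pos_part (f (u *\<^sub>R x + w *\<^sub>R y)) \<le> u * pos_part (f x) + w * pos_part (f y)"
    using uw by (simp add: pos_part_def)
  then have "(pos_part (f (u *\<^sub>R x + w *\<^sub>R y)))\<^sup>2 \<le> (u * pos_part (f x) + w * pos_part (f y))\<^sup>2"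
    by (intro power_mono) (auto simp: pos_part_def)
  also have "\<dots> \<le> u * (pos_part (f x))\<^sup>2 + w * (pos_part (f y))\<^sup>2"
    using convex_power2 uw unfolding convex_on_def by simp
  finally show "(pos_part (f (u *\<^sub>R x + w *\<^sub>R y)))\<^sup>2
      \<le> u * (pos_part (f x))\<^sup>2 + w * (pos_part (f y))\<^sup>2" .
qed

lemma convex_on_square_affine:
  assumes "affine_fun h"
  shows "convex_on UNIV (\<lambda>x. (h x)\<^sup>2)"
  unfolding convex_on_def
proof (intro conjI convex_UNIV ballI allI impI)
  fix x y and u w :: real
  assume uw: "0 \<le> u" "0 \<le> w" "u + w = 1"
  show "(h (u *\<^sub>R x + w *\<^sub>R y))\<^sup>2 \<le> u * (h x)\<^sup>2 + w * (h y)\<^sup>2"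
    using convex_power2 uw unfolding affine_fun_combination[OF assms uw(3)] convex_on_def by simp
qed

text \<open>Nothing is known about the values of \<open>f\<close> at the breakpoints, so the hypothesis speaks of open
  intervals only, and \<open>F\<close> is a continuous extension to the closed interval; the endpoints do not
  affect the integral. The interval is cut at the breakpoints one at a time.\<close>

lemma piecewise_continuous_integrable:
  fixes f :: "real \<Rightarrow> real"
  assumes "finite S"
    and "\<And>c d. c < d \<Longrightarrow> {c<..<d} \<subseteq> {a..b} - S \<Longrightarrow>
      \<exists>F. continuous_on {c..d} F \<and> (\<forall>t\<in>{c<..<d}. f t = F t)"
  shows "f integrable_on {a..b}"
  using assms
proof (induction S arbitrary: a b rule: finite_induct)
  case empty
  show ?case
  proof (cases "a < b")
    case True
    then obtain F where "continuous_on {a..b} F" "\<forall>t\<in>{a<..<b}. f t = F t"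
      using empty[of a b] by fastforce
    then show ?thesis
      using integrable_spike_interior[of a b f F]
      by (simp add: integrable_continuous_interval)
  next
    case False
    then show ?thesis using integrable_on_refl[of f b] by (cases "a = b") auto
  qed
next
  case (insert s S)
  have avoid: "{c<..<d} \<subseteq> {a..b} - insert s S"
    if "c < d" "{c<..<d} \<subseteq> {a'..b'} - S" "{a'..b'} \<subseteq> {a..b}" "s \<le> a' \<or> b' \<le> s" for a' b' c d
  proof -
    have "{c<..<d} \<subseteq> {a'..b'}" using that(2) by blast
    then have "a' \<le> c" "d \<le> b'" using \<open>c < d\<close> by (auto simp: greaterThanLessThan_subseteq_atLeastAtMost_iff)
    then have "s \<notin> {c<..<d}" using that(4) by auto
    then show ?thesis using that by blast
  qed
  have part: "f integrable_on {a'..b'}" if "{a'..b'} \<subseteq> {a..b}" "s \<le> a' \<or> b' \<le> s" for a' b'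
    using insert.prems avoid that by (intro insert.IH) blast
  show ?case
  proof (cases "a \<le> s \<and> s \<le> b")
    case True
    then have "f integrable_on {a..s}" "f integrable_on {s..b}" by (auto intro!: part)
    then show ?thesis using True by (intro Henstock_Kurzweil_Integration.integrable_combine[of a s b]) auto
  next
    case False
    then show ?thesis by (intro part) auto
  qed
qed

context
  fixes p :: "('nx::finite, 'nu::finite, 'Nu::finite, 'N::finite) ocp"
  assumes convex_p: "convex_ocp p"
begin

lemma convex_ocp_conditions:
  shows "0 \<le> t_ini p"
    and "C1_on ({0..} \<times> UNIV \<times> UNIV) (\<lambda>(t, x, u). costY p t x u)"
    and "\<forall>i<n_g p. C1_on ({0..} \<times> UNIV \<times> UNIV) (\<lambda>(t, x, u). path_g p i t x u)"
    and "\<forall>i<n_h p. C1_on ({0..} \<times> UNIV \<times> UNIV) (\<lambda>(t, x, u). path_h p i t x u)"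
    and "convex_on UNIV (costL p (t_fin p))"
    and "\<forall>t\<ge>0. convex_on UNIV (\<lambda>(x, u). costY p t x u)"
    and "\<forall>i<n_g p. \<forall>t\<ge>0. convex_on UNIV (\<lambda>(x, u). path_g p i t x u)"
    and "\<forall>i<n_h p. \<forall>t\<ge>0. affine_fun (\<lambda>(x, u). path_h p i t x u)"
    and "\<forall>i<n_P p. convex_on UNIV (\<lambda>(x, y). bnd_P p i (t_ini p) x (t_fin p) y)"
    and "\<forall>i<n_Q p. affine_fun (\<lambda>(x, y). bnd_Q p i (t_ini p) x (t_fin p) y)"
    and "\<forall>j. piecewise_polynomial_on (t_ini p) (t_fin p) (\<lambda>t. Gamma_u p t $ j)"
    and "\<forall>i<n_Uineq p. convex_on UNIV (U_ineq p i)"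
    and "\<forall>j<n_Ueq p. affine_fun (U_eq p j)"
    and "grid p 1 = t_ini p" and "grid p CARD('N) = t_fin p"
    and "strict_mono_on {1..CARD('N)} (grid p)"
  using convex_p unfolding convex_ocp_def by - (elim conjE, assumption)+

lemma grid_interval_subset:
  assumes "k \<in> {1..<CARD('N)}"
  shows "{grid p k..grid p (Suc k)} \<subseteq> {t_ini p..t_fin p}" and "0 \<le> t_ini p"
proof -
  note g = convex_ocp_conditions(14-16)
  have "mono_on {1..CARD('N)} (grid p)" using g(3) by (rule strict_mono_on_imp_mono_on)
  then have "grid p 1 \<le> grid p k" "grid p (Suc k) \<le> grid p CARD('N)"
    using assms by (auto intro: mono_onD)
  then show "{grid p k..grid p (Suc k)} \<subseteq> {t_ini p..t_fin p}" using g by auto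
  show "0 \<le> t_ini p" by (rule convex_ocp_conditions)
qed

lemma state_continuous:
  assumes "k \<in> {1..<CARD('N)}"
  shows "continuous_on {grid p k..grid p (Suc k)} (state p k x U)"
proof -
  have "continuous_on {grid p k..grid p (Suc k)} (Phi_x p k)"
    "continuous_on {grid p k..grid p (Suc k)} (Phi_u p k)"
    "continuous_on {grid p k..grid p (Suc k)} (phi_w p k)"
    using convex_p assms unfolding convex_ocp_def solves_ivp_def by blast+
  then show ?thesis
    unfolding state_def matrix_vector_mult_def by (intro continuous_intros)
qed

lemma control_piecewise_continuous:
  obtains S where "finite S"
    and "\<And>c d. c < d \<Longrightarrow> {c<..<d} \<subseteq> {t_ini p..t_fin p} - S \<Longrightarrow>
      \<exists>v. continuous_on {c..d} v \<and> (\<forall>t\<in>{c<..<d}. control p U t = v t)"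
proof -
  have "\<forall>j. \<exists>S. finite S \<and> (\<forall>c d. c < d \<and> {c<..<d} \<subseteq> {t_ini p..t_fin p} - S \<longrightarrow>
      (\<exists>q :: real poly. \<forall>t\<in>{c<..<d}. Gamma_u p t $ j = poly q t))"
    using convex_ocp_conditions unfolding piecewise_polynomial_on_def by simp
  then obtain S where S: "\<And>j. finite (S j)" "\<And>j c d. c < d \<Longrightarrow> {c<..<d} \<subseteq> {t_ini p..t_fin p} - S j \<Longrightarrow>
      \<exists>q :: real poly. \<forall>t\<in>{c<..<d}. Gamma_u p t $ j = poly q t"
    by metis
  show ?thesis
  proof
    show "finite (\<Union>j. S j)" using S(1) by simp
    fix c d :: real assume cd: "c < d" "{c<..<d} \<subseteq> {t_ini p..t_fin p} - (\<Union>j. S j)"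
    have "\<exists>q :: real poly. \<forall>t\<in>{c<..<d}. Gamma_u p t $ j = poly q t" for j
      using cd by (intro S(2)) auto
    then obtain q :: "'Nu \<Rightarrow> real poly" where q: "\<And>j t. t \<in> {c<..<d} \<Longrightarrow> Gamma_u p t $ j = poly (q j) t"
      by metis
    let ?v = "\<lambda>t. row_kron (\<chi> j. poly (q j) t) (mat 1) *v U"
    have "continuous_on {c..d} ?v"
      unfolding row_kron_def matrix_vector_mult_def by (simp, intro continuous_intros)
    moreover have "control p U t = ?v t" if "t \<in> {c<..<d}" for t
      using q[OF that] by (simp add: control_def row_kron_def)
    ultimately show "\<exists>v. continuous_on {c..d} v \<and> (\<forall>t\<in>{c<..<d}. control p U t = v t)" by blast
  qed
qed

lemma stage_integrand_integrable:
  fixes F :: "real \<Rightarrow> real^'nx \<Rightarrow> real^'nu \<Rightarrow> real"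
  assumes k: "k \<in> {1..<CARD('N)}"
    and F: "continuous_on ({0..} \<times> UNIV \<times> UNIV) (\<lambda>(t, x, u). F t x u)"
  shows "(\<lambda>t. F t (state p k x U t) (control p U t)) integrable_on {grid p k..grid p (Suc k)}"
proof -
  obtain S where S: "finite S"
    "\<And>c d. c < d \<Longrightarrow> {c<..<d} \<subseteq> {t_ini p..t_fin p} - S \<Longrightarrow>
      \<exists>v. continuous_on {c..d} v \<and> (\<forall>t\<in>{c<..<d}. control p U t = v t)"
    using control_piecewise_continuous by blast
  show ?thesis
  proof (rule piecewise_continuous_integrable[OF S(1)])
    fix c d :: real assume cd: "c < d" "{c<..<d} \<subseteq> {grid p k..grid p (Suc k)} - S"
    then have sub: "{c..d} \<subseteq> {grid p k..grid p (Suc k)}"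
      by (auto simp: subset_Diff_insert greaterThanLessThan_subseteq_atLeastAtMost_iff
          Diff_subset_conv dest!: order_trans[OF _ Diff_subset])
    obtain v where v: "continuous_on {c..d} v" "\<forall>t\<in>{c<..<d}. control p U t = v t"
      using S(2)[OF cd(1)] cd(2) grid_interval_subset[OF k] by blast
    have "continuous_on {c..d} (\<lambda>t. (t, state p k x U t, v t))"
      using continuous_on_subset[OF state_continuous[OF k] sub] v(1) by (intro continuous_intros)
    moreover have "(\<lambda>t. (t, state p k x U t, v t)) ` {c..d} \<subseteq> {0..} \<times> UNIV \<times> UNIV"
      using sub grid_interval_subset[OF k] by force
    ultimately have "continuous_on {c..d} (\<lambda>t. F t (state p k x U t) (v t))"
      using continuous_on_compose2[OF F, of "{c..d}" "\<lambda>t. (t, state p k x U t, v t)"] by simp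
    then show "\<exists>G. continuous_on {c..d} G \<and>
        (\<forall>t\<in>{c<..<d}. F t (state p k x U t) (control p U t) = G t)"
      using v(2) by (intro exI[of _ "\<lambda>t. F t (state p k x U t) (v t)"]) auto
  qed
qed

lemma state_combination:
  assumes "u + w = 1"
  shows "state p k (u *\<^sub>R x + w *\<^sub>R y) (u *\<^sub>R U + w *\<^sub>R V) t
    = u *\<^sub>R state p k x U t + w *\<^sub>R state p k y V t"
proof -
  have "phi_w p k t = u *\<^sub>R phi_w p k t + w *\<^sub>R phi_w p k t"
    using assms by (simp flip: scaleR_add_left)
  then have "state p k (u *\<^sub>R x + w *\<^sub>R y) (u *\<^sub>R U + w *\<^sub>R V) t
      = Phi_x p k t *v (u *\<^sub>R x + w *\<^sub>R y) + Phi_u p k t *v (u *\<^sub>R U + w *\<^sub>R V)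
        + (u *\<^sub>R phi_w p k t + w *\<^sub>R phi_w p k t)"
    unfolding state_def by (rule arg_cong)
  then show ?thesis
    by (simp add: state_def matrix_vector_right_distrib matrix_vector_mult_scaleR scaleR_add_right)
qed

lemma control_combination:
  "control p (u *\<^sub>R U + w *\<^sub>R V) t = u *\<^sub>R control p U t + w *\<^sub>R control p V t"
  by (simp add: control_def matrix_vector_right_distrib matrix_vector_mult_scaleR)

text \<open>Stage costs and path violations are both of this form. The Henstock-Kurzweil integral of a non-integrable function is 0 by convention, so monotonicity and
  additivity of the integral, and with them convexity, rest on integrability of all integrands.\<close>

lemma stage_integral_convex:
  assumes k: "k \<in> {1..<CARD('N)}"
    and F: "continuous_on ({0..} \<times> UNIV \<times> UNIV) (\<lambda>(t, x, u). F t x u)"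
    and cvx: "\<And>t. 0 \<le> t \<Longrightarrow> convex_on UNIV (\<lambda>(x, u). F t x u)"
  shows "convex_on UNIV (\<lambda>(X, U). integral {grid p k..grid p (Suc k)}
    (\<lambda>t. F t (state p k (X $ node p k) U t) (control p U t)))"
  unfolding convex_on_def
proof (intro conjI convex_UNIV ballI allI impI)
  fix z1 z2 :: "('nx, 'nu, 'Nu, 'N) decision" and u w :: real
  assume uw: "0 \<le> u" "0 \<le> w" "u + w = 1"
  obtain X U where z1: "z1 = (X, U)" by (cases z1)
  obtain Y V where z2: "z2 = (Y, V)" by (cases z2)
  let ?I = "{grid p k..grid p (Suc k)}"
  let ?f = "\<lambda>X U t. F t (state p k (X $ node p k) U t) (control p U t)"
  have int: "?f X U integrable_on ?I" for X U
    using stage_integrand_integrable[OF k F] .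
  have "?f (u *\<^sub>R X + w *\<^sub>R Y) (u *\<^sub>R U + w *\<^sub>R V) t \<le> u * ?f X U t + w * ?f Y V t" if "t \<in> ?I" for t
  proof -
    have "0 \<le> t" using that grid_interval_subset[OF k] by force
    then have "(\<lambda>(x, u). F t x u) (u *\<^sub>R (state p k (X $ node p k) U t, control p U t)
        + w *\<^sub>R (state p k (Y $ node p k) V t, control p V t)) \<le> u * ?f X U t + w * ?f Y V t"
      using cvx uw unfolding convex_on_def by (metis (no_types, lifting) UNIV_I case_prod_conv)
    then show ?thesis
      by (simp add: state_combination[OF uw(3)] control_combination)
  qed
  then have "integral ?I (?f (u *\<^sub>R X + w *\<^sub>R Y) (u *\<^sub>R U + w *\<^sub>R V))
      \<le> integral ?I (\<lambda>t. u * ?f X U t + w * ?f Y V t)"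
    by (intro integral_le integrable_add integrable_on_mult_right int)
  also have "\<dots> = u * integral ?I (?f X U) + w * integral ?I (?f Y V)"
    using int by (subst integral_add) (auto intro!: integrable_on_mult_right)
  finally show "(\<lambda>(X, U). integral ?I (?f X U)) (u *\<^sub>R z1 + w *\<^sub>R z2)
      \<le> u * (\<lambda>(X, U). integral ?I (?f X U)) z1 + w * (\<lambda>(X, U). integral ?I (?f X U)) z2"
    by (simp add: z1 z2)
qed

lemma stage_cost_convex:
  assumes "k \<in> {1..<CARD('N)}"
  shows "convex_on UNIV (\<lambda>(X, U). stage_cost p k (X $ node p k) U)"
  unfolding stage_cost_def
proof (rule stage_integral_convex[OF assms])
  show "continuous_on ({0..} \<times> UNIV \<times> UNIV) (\<lambda>(t, x, u). costY p t x u)"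
    using convex_ocp_conditions by (intro C1_on_imp_continuous_on) simp
  show "convex_on UNIV (\<lambda>(x, u). costY p t x u)" if "0 \<le> t" for t
    using convex_ocp_conditions that by simp
qed

lemma path_violation_convex:
  assumes k: "k \<in> {1..<CARD('N)}"
  shows "convex_on UNIV (\<lambda>(X, U). path_violation p k (X $ node p k) U)"
  unfolding path_violation_def
proof (rule stage_integral_convex[OF k])
  let ?D = "{0::real..} \<times> (UNIV :: (real^'nx) set) \<times> (UNIV :: (real^'nu) set)"
  have g: "continuous_on ?D (\<lambda>(t, x, u). path_g p i t x u)" if "i < n_g p" for i
    using convex_ocp_conditions that by (intro C1_on_imp_continuous_on) simp
  have h: "continuous_on ?D (\<lambda>(t, x, u). path_h p i t x u)" if "i < n_h p" for i
    using convex_ocp_conditions that by (intro C1_on_imp_continuous_on) simp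
  show "continuous_on ?D (\<lambda>(t, x, u). (\<Sum>i<n_g p. (pos_part (path_g p i t x u))\<^sup>2) +
      (\<Sum>i<n_h p. (path_h p i t x u)\<^sup>2))"
    using g h unfolding case_prod_unfold pos_part_def by (intro continuous_intros) auto
  fix t :: real assume t: "0 \<le> t"
  have "convex_on UNIV (\<lambda>z. (pos_part (path_g p i t (fst z) (snd z)))\<^sup>2)" if "i < n_g p" for i
    using convex_ocp_conditions that t unfolding case_prod_unfold
    by (intro convex_on_square_pos_part) simp
  moreover have "convex_on UNIV (\<lambda>z. (path_h p i t (fst z) (snd z))\<^sup>2)" if "i < n_h p" for i
    using convex_ocp_conditions that t unfolding case_prod_unfold
    by (intro convex_on_square_affine) simp
  ultimately show "convex_on UNIV (\<lambda>(x, u). (\<Sum>i<n_g p. (pos_part (path_g p i t x u))\<^sup>2) +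
      (\<Sum>i<n_h p. (path_h p i t x u)\<^sup>2))"
    unfolding case_prod_unfold
    by (intro convex_on_add convex_on_finite_sum) auto
qed

lemma linear_node: "linear (\<lambda>z :: ('nx, 'nu, 'Nu, 'N) decision. fst z $ n)"
  by (rule linearI) auto

lemma linear_boundary: "linear (\<lambda>z :: ('nx, 'nu, 'Nu, 'N) decision. (fst z $ m, fst z $ n))"
  by (rule linearI) auto

lemma cost_convex: "convex_on UNIV (cost p)"
proof -
  have "convex_on UNIV (\<lambda>z :: ('nx, 'nu, 'Nu, 'N) decision. costL p (t_fin p) (fst z $ node p CARD('N)))"
    by (rule convex_on_compose_linear[OF convex_ocp_conditions(5) linear_node])
  moreover have "convex_on UNIV (\<lambda>z. \<Sum>k\<in>{1..<CARD('N)}. stage_cost p k (fst z $ node p k) (snd z))"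
    using stage_cost_convex unfolding case_prod_unfold
    by (intro convex_on_finite_sum) auto
  ultimately show ?thesis
    unfolding cost_def case_prod_unfold by (rule convex_on_add)
qed

lemma ineq_con_convex:
  assumes "i \<in> ineq_labels p"
  shows "convex_on UNIV (ineq_con p i)"
proof -
  consider k where "i = Path k" "k \<in> {1..<CARD('N)}" | j where "i = BndP j" "j < n_P p"
    | j where "i = UIneq j" "j < n_Uineq p"
    using assms by (auto simp: ineq_labels_def)
  then show ?thesis
  proof cases
    case 1
    have "ineq_con p i = (\<lambda>z. (\<lambda>(X, U). path_violation p k (X $ node p k) U) z + (- eps p))"
      by (auto simp: 1)
    then show ?thesis
      using path_violation_convex[OF 1(2)] by (simp only:) (intro convex_on_add; simp add: convex_on_const)
  next
    case 2
    have "convex_on UNIV (\<lambda>(x, y). bnd_P p j (t_ini p) x (t_fin p) y)"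
      using convex_ocp_conditions 2(2) by simp
    from convex_on_compose_linear[OF this linear_boundary[of "node p 1" "node p CARD('N)"]]
    show ?thesis by (rule back_subst[of "convex_on UNIV"]) (auto simp: 2)
  next
    case 3
    have "convex_on UNIV (U_ineq p j)"
      using convex_ocp_conditions 3(2) by simp
    from convex_on_compose_linear[OF this linear_snd]
    show ?thesis by (rule back_subst[of "convex_on UNIV"]) (auto simp: 3)
  qed
qed

lemma eq_con_affine:
  assumes "j \<in> eq_labels p"
  shows "affine_fun (eq_con p j)"
proof -
  consider k i where "j = Dyn k i" | i where "j = BndQ i" "i < n_Q p"
    | i where "j = UEq i" "i < n_Ueq p"
    using assms by (auto simp: eq_labels_def)
  then show ?thesis
  proof cases
    case 1
    let ?l = "\<lambda>z :: ('nx, 'nu, 'Nu, 'N) decision.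
      (fst z $ node p (Suc k) - (A_step p k *v (fst z $ node p k) + B_step p k *v snd z)) $ i"
    have "linear ?l"
      by (rule linearI)
        (auto simp: matrix_vector_right_distrib matrix_vector_mult_scaleR algebra_simps)
    moreover have "eq_con p j = (\<lambda>z. ?l z + (- (w_step p k $ i)))"
      by (auto simp: 1)
    ultimately show ?thesis unfolding affine_fun_def by blast
  next
    case 2
    have "affine_fun (\<lambda>(x, y). bnd_Q p i (t_ini p) x (t_fin p) y)"
      using convex_ocp_conditions 2(2) by simp
    from affine_fun_compose_linear[OF this linear_boundary[of "node p 1" "node p CARD('N)"]]
    show ?thesis by (rule back_subst[of affine_fun]) (auto simp: 2)
  next
    case 3
    have "affine_fun (U_eq p i)"
      using convex_ocp_conditions 3(2) by simp
    from affine_fun_compose_linear[OF this linear_snd]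
    show ?thesis by (rule back_subst[of affine_fun]) (auto simp: 3)
  qed
qed

section \<open>Exactness of the penalty\<close>

lemma kkt_multipliers_exist:
  assumes "strong_slater p" and z: "z \<in> cvx_minimizers p"
  obtains lam mu where "kkt p z lam mu"
proof -
  obtain z0 where z0: "\<forall>j\<in>eq_labels p. eq_con p j z0 = 0" "\<forall>i\<in>ineq_labels p. ineq_con p i z0 < 0"
    using assms(1) unfolding strong_slater_def by blast
  have fin: "finite (ineq_labels p)" "finite (eq_labels p)"
    by (auto simp: ineq_labels_def eq_labels_def)
  have feas: "z \<in> cvx_feasible p" and min: "\<And>y. y \<in> cvx_feasible p \<Longrightarrow> cost p z \<le> cost p y"
    using z by (auto simp: cvx_minimizers_def)
  show ?thesis
  proof (rule convex_kkt_conditions[where f = "cost p" and g = "ineq_con p" and h = "eq_con p"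
        and ?z0.0 = z0 and z = z, OF fin cost_convex ineq_con_convex eq_con_affine])
    fix lam mu s0 s
    assume "\<And>i. i \<in> ineq_labels p \<Longrightarrow> 0 \<le> lam i" "\<And>i. i \<in> ineq_labels p \<Longrightarrow> lam i * ineq_con p i z = 0"
      "s0 \<in> subdifferential (\<lambda>y. ereal (cost p y)) z"
      "\<And>i. i \<in> ineq_labels p \<Longrightarrow> s i \<in> subdifferential (\<lambda>y. ereal (ineq_con p i y)) z"
      "s0 + (\<Sum>i\<in>ineq_labels p. lam i *\<^sub>R s i)
        + (\<Sum>j\<in>eq_labels p. mu j *\<^sub>R gradient (eq_con p j) z) = 0"
    then have "kkt p z lam mu" using feas unfolding kkt_def by blast
    then show ?thesis by (rule that)
  qed (use z0 feas min in \<open>auto simp: cvx_feasible_iff_labels\<close>)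
qed

text \<open>Weighting the subgradient inequalities with the multipliers and adding them up, the linear terms
  cancel by stationarity and the constraint terms at \<open>z\<close> by complementary slackness.\<close>

lemma kkt_lagrangian_lower_bound:
  assumes kkt: "kkt p z lam mu"
  shows "cost p z \<le> cost p y + (\<Sum>i\<in>ineq_labels p. lam i * ineq_con p i y)
    + (\<Sum>j\<in>eq_labels p. mu j * eq_con p j y)"
proof -
  obtain s0 s where s0: "cost p z + s0 \<bullet> (y - z) \<le> cost p y"
    and s: "\<And>i. i \<in> ineq_labels p \<Longrightarrow> ineq_con p i z + s i \<bullet> (y - z) \<le> ineq_con p i y"
    and lam: "\<And>i. i \<in> ineq_labels p \<Longrightarrow> 0 \<le> lam i" "\<And>i. i \<in> ineq_labels p \<Longrightarrow> lam i * ineq_con p i z = 0"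
    and stat: "s0 + (\<Sum>i\<in>ineq_labels p. lam i *\<^sub>R s i)
      + (\<Sum>j\<in>eq_labels p. mu j *\<^sub>R gradient (eq_con p j) z) = 0"
    and feas: "z \<in> cvx_feasible p"
    using kkt unfolding kkt_def subdifferential_real_iff by blast
  have "lam i * (s i \<bullet> (y - z)) \<le> lam i * ineq_con p i y" if "i \<in> ineq_labels p" for i
    using mult_left_mono[OF s lam(1), OF that that] lam(2)[OF that] by (simp add: distrib_left)
  then have "(\<Sum>i\<in>ineq_labels p. lam i *\<^sub>R s i) \<bullet> (y - z) \<le> (\<Sum>i\<in>ineq_labels p. lam i * ineq_con p i y)"
    by (simp add: inner_sum_left sum_mono)
  moreover have "(\<Sum>j\<in>eq_labels p. mu j *\<^sub>R gradient (eq_con p j) z) \<bullet> (y - z)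
      = (\<Sum>j\<in>eq_labels p. mu j * eq_con p j y)"
    unfolding inner_sum_left
    using affine_fun_gradient[OF eq_con_affine, of _ y z] feas
    by (intro sum.cong) (auto simp: cvx_feasible_iff_labels)
  moreover have "s0 \<bullet> (y - z) + (\<Sum>i\<in>ineq_labels p. lam i *\<^sub>R s i) \<bullet> (y - z)
      + (\<Sum>j\<in>eq_labels p. mu j *\<^sub>R gradient (eq_con p j) z) \<bullet> (y - z) = 0"
    unfolding inner_add_left[symmetric] stat by simp
  ultimately show ?thesis using s0 by linarith
qed

lemma Z_set_iff_labels:
  "z \<in> Z_set p \<longleftrightarrow> (\<forall>i\<in>ineq_labels p - range Path. ineq_con p i z \<le> 0) \<and>
    (\<forall>j\<in>eq_labels p. eq_con p j z = 0)"
proof -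
  have "ineq_labels p - range Path = BndP ` {..<n_P p} \<union> UIneq ` {..<n_Uineq p}"
    by (auto simp: ineq_labels_def)
  then show ?thesis
    by (cases z) (auto simp: Z_set_def U_set_def eq_labels_def ball_Un vec_eq_iff)
qed

end

text \<open>The constraint functions \<open>ineq_con p (Path k)\<close> already contain the tolerance \<open>eps p\<close>, so the penalty
  is the sum in the definition of \<open>Theta\<close>.\<close>

definition penalty :: "('nx::finite, 'nu::finite, 'Nu::finite, 'N::finite) ocp
    \<Rightarrow> ('nx, 'nu, 'Nu, 'N) decision \<Rightarrow> real" where
  "penalty p z = (\<Sum>k\<in>{1..<CARD('N)}. pos_part (ineq_con p (Path k) z))"

lemma Theta_eq:
  "Theta p \<gamma> z = (if z \<in> Z_set p then ereal (cost p z + \<gamma> * penalty p z) else \<infinity>)"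
  by (cases z) (simp add: Theta_def set_indicator_def penalty_def)

lemma penalty_nonneg: "0 \<le> penalty p z"
  by (auto simp: penalty_def pos_part_def intro!: sum_nonneg)

lemma cvx_feasible_iff_penalty: "z \<in> cvx_feasible p \<longleftrightarrow> z \<in> Z_set p \<and> penalty p z = 0"
  by (cases z)
    (auto simp: cvx_feasible_def penalty_def sum_nonneg_eq_0_iff pos_part_def max_def split: if_splits)

lemma stationary_iff_penalized_minimizer:
  "0 \<in> subdifferential (Theta p \<gamma>) z \<longleftrightarrow> z \<in> Z_set p \<and>
    (\<forall>y\<in>Z_set p. cost p z + \<gamma> * penalty p z \<le> cost p y + \<gamma> * penalty p y)"
  by (auto simp: subdifferential_def Theta_eq)

text \<open>On \<open>\<Z>\<close> the equality terms of the Lagrangian vanish and the boundary and control inequalities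
  contribute nonpositive terms. What remains is compared termwise with the penalty, using
  \<open>lam v \<le> lam pos_part v \<le> \<gamma> pos_part v\<close>; the second inequality is strict where \<open>v > 0\<close>.\<close>

lemma penalized_cost_gap:
  fixes p :: "('nx::finite, 'nu::finite, 'Nu::finite, 'N::finite) ocp"
  assumes p: "convex_ocp p" and kkt: "kkt p z lam mu" and y: "y \<in> Z_set p"
    and less: "\<And>k. k \<in> {1..<CARD('N)} \<Longrightarrow> lam (Path k) < \<gamma>"
  shows "cost p z \<le> cost p y + \<gamma> * penalty p y"
    and "y \<notin> cvx_feasible p \<Longrightarrow> cost p z < cost p y + \<gamma> * penalty p y"
proof -
  let ?K = "{1..<CARD('N)}"
  let ?v = "\<lambda>k. ineq_con p (Path k) y"
  have lam: "0 \<le> lam i" if "i \<in> ineq_labels p" for i using kkt that by (simp add: kkt_def)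
  have P: "Path ` ?K \<subseteq> ineq_labels p" and fin: "finite (ineq_labels p)"
    by (auto simp: ineq_labels_def)
  have "(\<Sum>j\<in>eq_labels p. mu j * eq_con p j y) = 0"
    using y Z_set_iff_labels[OF p, of y] by simp
  moreover have "(\<Sum>i\<in>ineq_labels p. lam i * ineq_con p i y) \<le> (\<Sum>k\<in>?K. lam (Path k) * ?v k)"
  proof -
    have "lam i * ineq_con p i y \<le> 0" if "i \<in> ineq_labels p - Path ` ?K" for i
    proof -
      have "i \<in> ineq_labels p - range Path" using that by (auto simp: ineq_labels_def)
      then show ?thesis
        using y Z_set_iff_labels[OF p, of y] lam[of i] by (simp add: mult_nonneg_nonpos)
    qed
    then have "(\<Sum>i\<in>ineq_labels p - Path ` ?K. lam i * ineq_con p i y) \<le> 0" by (rule sum_nonpos)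
    moreover have "(\<Sum>i\<in>Path ` ?K. lam i * ineq_con p i y) = (\<Sum>k\<in>?K. lam (Path k) * ?v k)"
      by (subst sum.reindex) (auto simp: inj_on_def)
    ultimately show ?thesis using sum.subset_diff[OF P fin, of "\<lambda>i. lam i * ineq_con p i y"] by simp
  qed
  ultimately have low: "cost p z \<le> cost p y + (\<Sum>k\<in>?K. lam (Path k) * ?v k)"
    using kkt_lagrangian_lower_bound[OF p kkt, of y] by linarith
  have term_le: "lam (Path k) * ?v k \<le> \<gamma> * pos_part (?v k)" if "k \<in> ?K" for k
  proof -
    have "0 \<le> lam (Path k)" using P that by (intro lam) auto
    then have "lam (Path k) * ?v k \<le> lam (Path k) * pos_part (?v k)"
      by (intro mult_left_mono) (simp_all add: pos_part_def)
    also have "\<dots> \<le> \<gamma> * pos_part (?v k)"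
      using less[OF that] by (intro mult_right_mono) (simp_all add: pos_part_def)
    finally show ?thesis .
  qed
  have pen: "\<gamma> * penalty p y = (\<Sum>k\<in>?K. \<gamma> * pos_part (?v k))"
    by (simp add: penalty_def sum_distrib_left)
  show "cost p z \<le> cost p y + \<gamma> * penalty p y"
    using low sum_mono[OF term_le, of ?K "\<lambda>k. k"] unfolding pen by simp
  assume "y \<notin> cvx_feasible p"
  then obtain k where k: "k \<in> ?K" "0 < ?v k"
    using y by (cases y) (auto simp: cvx_feasible_def not_le)
  then have "lam (Path k) * ?v k < \<gamma> * pos_part (?v k)"
    using less by (simp add: pos_part_def)
  then have "(\<Sum>k\<in>?K. lam (Path k) * ?v k) < (\<Sum>k\<in>?K. \<gamma> * pos_part (?v k))"
    using k(1) term_le by (intro sum_strict_mono_ex1) auto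
  then show "cost p z < cost p y + \<gamma> * penalty p y"
    using low unfolding pen by simp
qed

text \<open>If \<open>z\<close> is stationary and \<open>zs\<close> is a minimizer of the constrained problem, then the penalized cost of
  \<open>z\<close> is at most that of \<open>zs\<close>, which is just its cost. The strict gap at infeasible points therefore forces
  \<open>z\<close> to be feasible, hence optimal.\<close>

theorem theorem29:
  fixes p :: "('nx::finite, 'nu::finite, 'Nu::finite, 'N::finite) ocp" and \<gamma> :: real
  assumes "convex_ocp p"
    and "cvx_minimizers p \<noteq> {}"
    and "strong_slater p"
    and "\<gamma> > 0"
    and "\<forall>m\<in>lagrange_multipliers p. \<bar>m\<bar> < \<gamma>"
  shows "{z. 0 \<in> subdifferential (Theta p \<gamma>) z} = cvx_minimizers p"
proof -
  have gap: "cost p z \<le> cost p y + \<gamma> * penalty p y"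
    "y \<notin> cvx_feasible p \<Longrightarrow> cost p z < cost p y + \<gamma> * penalty p y"
    if z: "z \<in> cvx_minimizers p" and y: "y \<in> Z_set p" for z y
  proof -
    obtain lam mu where kkt: "kkt p z lam mu"
      using kkt_multipliers_exist[OF assms(1,3) z] .
    have "lam (Path k) < \<gamma>" if "k \<in> {1..<CARD('N)}" for k
    proof -
      have "Path k \<in> ineq_labels p" using that by (simp add: ineq_labels_def)
      then have "lam (Path k) \<in> lagrange_multipliers p"
        unfolding lagrange_multipliers_def using z kkt by blast
      then show ?thesis using assms(5) by fastforce
    qed
    then show "cost p z \<le> cost p y + \<gamma> * penalty p y"
      "y \<notin> cvx_feasible p \<Longrightarrow> cost p z < cost p y + \<gamma> * penalty p y"
      using penalized_cost_gap[OF assms(1) kkt y, of \<gamma>] by blast+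
  qed
  have feas: "z \<in> Z_set p" "penalty p z = 0" if "z \<in> cvx_minimizers p" for z
    using that by (auto simp: cvx_minimizers_def cvx_feasible_iff_penalty)
  obtain zs where zs: "zs \<in> cvx_minimizers p" using assms(2) by blast
  show ?thesis
  proof (intro set_eqI iffI; unfold mem_Collect_eq stationary_iff_penalized_minimizer)
    fix z assume "z \<in> cvx_minimizers p"
    then show "z \<in> Z_set p \<and>
        (\<forall>y\<in>Z_set p. cost p z + \<gamma> * penalty p z \<le> cost p y + \<gamma> * penalty p y)"
      using gap(1) feas by simp
  next
    fix z
    assume z: "z \<in> Z_set p \<and>
        (\<forall>y\<in>Z_set p. cost p z + \<gamma> * penalty p z \<le> cost p y + \<gamma> * penalty p y)"
    then have le: "cost p z + \<gamma> * penalty p z \<le> cost p zs" using feas[OF zs] by fastforce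
    then have feasible: "z \<in> cvx_feasible p" using gap(2)[OF zs, of z] z by force
    then have "cost p z \<le> cost p zs" using le by (simp add: cvx_feasible_iff_penalty)
    then show "z \<in> cvx_minimizers p"
      using feasible zs unfolding cvx_minimizers_def by fastforce
  qed
qed

end
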